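(* Let $\theta\in\mathbb{R}^m$ be fixed. Let $(\hat\theta_t)_{t\ge 0}$ be defined by $$\hat\theta_t=\hat\theta_{t-1}+\Gamma_t^{-1}(\hat\theta_{t-1})\,\psi_t(\hat\theta_{t-1}),\qquad t\ge 1,$$ with initial point $\hat\theta_0\in\mathbb{R}^m$, put $\Delta_t=\hat\theta_t-\theta$, and for $u\in\mathbb{R}^m$ put $b_t(\theta,u)=E_\theta\{\psi_t(\theta+u)\mid\mathcal{F}_{t-1}\}$, $t\ge1$. Suppose that there exists a real-valued nonnegative function $V_\theta:\mathbb{R}^m\to\mathbb{R}$ having continuous and bounded partial second derivatives such that, with $$\mathcal{N}_t(u)=\dot V_\theta(u)\,\Gamma_t^{-1}(\theta+u)\,b_t(\theta,u)+\frac12\sup_{v}\|\ddot V_\theta(v)\|\;E_\theta\left\{\|\Gamma_t^{-1}(\theta+u)\psi_t(\theta+u)\|^2\mid\mathcal{F}_{t-1}\right\},$$ the following hold: (G1) $V_\theta(0)=0$, and for each $\varepsilon\in(0,1)$, $\inf_{\|u\|\ge\varepsilon}V_\theta(u)>0$; (G2) there exists a set $A\in\mathcal{F}$ with $P^\theta(A)>0$ such that for each $\varepsilon\in(0,1)$, $$\sum_{t=1}^\infty\ \inf_{\varepsilon\le V_\theta(u)\le1/\varepsilon}\left[\mathcal{N}_t(u)\right]^-=\infty\quad\text{on }A;$$ (G3) $$\sum_{t=1}^\infty\left(1+V_\theta(\Delta_{t-1})\right)^{-1}\left[\mathcal{N}_t(\Delta_{t-1})\right]^+<\infty,\qquad P^\theta\text{-a.s.}$$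 Then $\hat\theta_t\to\theta$ $P^\theta$-a.s., for any initial value $\hat\theta_0\in\mathbb{R}^m$.
   Context: Setting. $X_1,X_2,\dots$ are observations taking values in a measurable space $(\mathbf{X},\mathcal{B}(\mathbf{X}))$ equipped with a $\sigma$-finite measure $\mu$, defined on $(\Omega,\mathcal{F})$ with a family of probability measures $\{P^\theta:\theta\in\mathbb{R}^m\}$. For each $t\ge1$ there is, under $P^\theta$, a regular conditional probability density (w.r.t. $\mu$) $f_t(\theta,x_t\mid x_1^{t-1})=f_t(\theta,x_t\mid x_{t-1},\dots,x_1)$ of $X_t$ given the past observations ($f_1(\theta,\cdot)$ is the density of $X_1$). $\mathcal{F}_t=\sigma(X_1,\dots,X_t)$, $\mathcal{F}_0$ is the trivial $\sigma$-algebra. Conditional expectations $E_\theta\{\cdot\mid\mathcal{F}_{t-1}\}$ under $P^\theta$ are always computed as integrals w.r.t. these conditional densities, i.e. $E_\theta\{\varphi(X_t,\dots,X_1)\mid\mathcal{F}_{t-1}\}=\int\varphi(z,X_{t-1},\dots,X_1)f_t(\theta,z\mid X_1^{t-1})\mu(dz)$, and are assumed well defined. Relations between random variables are meant with probability one w.r.t. $P^\theta$ unless specified otherwise. A process indexed by $t\ge 1$ is predictable if its value at time $t$ is $\mathcal{F}_{t-1}$-measurable for each $t\ge1$. For each $t\ge1$, $\psi_t:\mathbb{R}^m\times\mathbf{X}^t\to\mathbb{R}^m$ is a Borel function and $\psi_t(v)=\psi_t(v,X_t,X_{t-1},\dots,X_1)$. For each $v\in\mathbb{R}^m$, $(\Gamma_t(v))_{t\ge1}$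 is a predictable process of $m\times m$ matrices with $\det\Gamma_t(v)\neq0$; $\Gamma_t(v)$ is given by a jointly measurable function of $(v,X_{t-1},\dots,X_1)$. $\Gamma_t^{-1}(v)$ is the inverse matrix. $\dot V_\theta(u)$ is the row vector of first partial derivatives of $V_\theta$ at $u$, and $\ddot V_\theta(u)$ is the $m\times m$ matrix of second partial derivatives. $\|\cdot\|$ is the Euclidean norm of vectors and the induced operator norm of matrices. $[a]^+=\max(a,0)$ and $[a]^-=\max(-a,0)$ are the positive and negative parts of $a$.
   Formalization: Convergence of the estimator to θ is asserted almost surely on the set A of (G2), not on the whole space; with only P(A)>0 the claim fails off A, and when P(A)=1 the formal statement gives the full conclusion. *)

theory Defs
  imports "HOL-Probability.Probability"
begin

section \<open>Observations and conditional densities\<close>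

text \<open>A finite sequence \<open>x\<^sub>1, \<dots>, x\<^sub>t\<close> of observations is an element of the product
  \<open>Pi\<^sub>M {1..t} (\<lambda>_. \<mu>)\<close>, i.e. an extensional function on \<open>{1..t}\<close>. If \<open>h\<close> is the past
  \<open>x\<^sub>1, \<dots>, x\<^sub>t\<^sub>-\<^sub>1\<close>, then \<open>h(t := z)\<close> is the sequence prolonged by \<open>x\<^sub>t = z\<close>.\<close>

definition hist :: "(nat \<Rightarrow> 'w \<Rightarrow> 'x) \<Rightarrow> nat \<Rightarrow> 'w \<Rightarrow> (nat \<Rightarrow> 'x)" where
  "hist X t \<omega> = (\<lambda>i\<in>{1..t}. X i \<omega>)"

definition obs_algebra :: "'w measure \<Rightarrow> 'x measure \<Rightarrow> (nat \<Rightarrow> 'w \<Rightarrow> 'x) \<Rightarrow> nat \<Rightarrow> 'w measure" where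
  "obs_algebra \<F> \<mu> X t =
     sigma (space \<F>) (\<Union>i\<in>{1..t}. {X i -` B \<inter> space \<F> | B. B \<in> sets \<mu>})"

text \<open>\<open>\<F>\<close> only serves as the measurable space carrying the family \<open>P\<close>; the observation space is
  \<open>\<mu>\<close> with its own sigma-algebra. \<open>f t \<theta> z h\<close> stands for \<open>f\<^sub>t(\<theta>, z | h)\<close>.\<close>

locale observation_model =
  fixes \<F> :: "'w measure"
    and \<mu> :: "'x measure"
    and P :: "real^'m \<Rightarrow> 'w measure"
    and X :: "nat \<Rightarrow> 'w \<Rightarrow> 'x"
    and f :: "nat \<Rightarrow> real^'m \<Rightarrow> 'x \<Rightarrow> (nat \<Rightarrow> 'x) \<Rightarrow> real"
  assumes prob: "\<And>\<theta>. prob_space (P \<theta>)"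
    and sets_P: "\<And>\<theta>. sets (P \<theta>) = sets \<F>"
    and sigma_finite: "sigma_finite_measure \<mu>"
    and obs: "\<And>t. t \<ge> 1 \<Longrightarrow> X t \<in> \<F> \<rightarrow>\<^sub>M \<mu>"
    and density_measurable: "\<And>t \<theta>. t \<ge> 1 \<Longrightarrow>
          (\<lambda>(z, h). f t \<theta> z h) \<in> borel_measurable (\<mu> \<Otimes>\<^sub>M Pi\<^sub>M {1..t - 1} (\<lambda>_. \<mu>))"
    and density_nonneg: "\<And>t \<theta> z h. t \<ge> 1 \<Longrightarrow> z \<in> space \<mu> \<Longrightarrow>
          h \<in> space (Pi\<^sub>M {1..t - 1} (\<lambda>_. \<mu>)) \<Longrightarrow> 0 \<le> f t \<theta> z h"
    and density_total: "\<And>t \<theta> h. t \<ge> 1 \<Longrightarrow> h \<in> space (Pi\<^sub>M {1..t - 1} (\<lambda>_. \<mu>)) \<Longrightarrow>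
          (\<integral>\<^sup>+ z. ennreal (f t \<theta> z h) \<partial>\<mu>) = 1"
    and density_cond: "\<And>t \<theta> B. t \<ge> 1 \<Longrightarrow> B \<in> sets \<mu> \<Longrightarrow>
          AE \<omega> in P \<theta>.
            real_cond_exp (P \<theta>) (obs_algebra \<F> \<mu> X (t - 1)) (\<lambda>\<omega>'. indicator B (X t \<omega>')) \<omega>
            = (\<integral>z. f t \<theta> z (hist X (t - 1) \<omega>) * indicator B z \<partial>\<mu>)"

text \<open>\<open>E\<^sub>\<theta>{\<phi>(X\<^sub>t, \<dots>, X\<^sub>1) | \<F>\<^sub>t\<^sub>-\<^sub>1}\<close> computed from the conditional density, as a function of the past
  \<open>h\<close>. The argument \<open>g\<close> is \<open>z \<mapsto> h \<mapsto> f\<^sub>t(\<theta>, z | h)\<close>.\<close>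

definition cond_mean ::
    "'x measure \<Rightarrow> ('x \<Rightarrow> (nat \<Rightarrow> 'x) \<Rightarrow> real) \<Rightarrow> nat \<Rightarrow>
     ((nat \<Rightarrow> 'x) \<Rightarrow> 'b :: {banach, second_countable_topology}) \<Rightarrow> (nat \<Rightarrow> 'x) \<Rightarrow> 'b" where
  "cond_mean \<mu> g t \<phi> h = (\<integral>z. g z h *\<^sub>R \<phi> (h(t := z)) \<partial>\<mu>)"

definition cond_mean_exists ::
    "'x measure \<Rightarrow> ('x \<Rightarrow> (nat \<Rightarrow> 'x) \<Rightarrow> real) \<Rightarrow> nat \<Rightarrow>
     ((nat \<Rightarrow> 'x) \<Rightarrow> 'b :: {banach, second_countable_topology}) \<Rightarrow> (nat \<Rightarrow> 'x) \<Rightarrow> bool" where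
  "cond_mean_exists \<mu> g t \<phi> h \<longleftrightarrow> integrable \<mu> (\<lambda>z. g z h *\<^sub>R \<phi> (h(t := z)))"


section \<open>Partial derivatives\<close>

definition partial_deriv :: "'m \<Rightarrow> (real^'m::finite \<Rightarrow> real) \<Rightarrow> real^'m \<Rightarrow> real" where
  "partial_deriv i V u = deriv (\<lambda>s. V (u + s *\<^sub>R axis i 1)) 0"

definition has_partial_deriv :: "'m \<Rightarrow> (real^'m::finite \<Rightarrow> real) \<Rightarrow> bool" where
  "has_partial_deriv i V \<longleftrightarrow> (\<forall>u. (\<lambda>s. V (u + s *\<^sub>R axis i 1)) field_differentiable (at 0))"

definition gradient :: "(real^'m::finite \<Rightarrow> real) \<Rightarrow> real^'m \<Rightarrow> real^'m" where
  "gradient V u = (\<chi> i. partial_deriv i V u)"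

definition hessian :: "(real^'m::finite \<Rightarrow> real) \<Rightarrow> real^'m \<Rightarrow> real^'m^'m" where
  "hessian V u = (\<chi> i j. partial_deriv j (partial_deriv i V) u)"

definition C2_bounded :: "(real^'m::finite \<Rightarrow> real) \<Rightarrow> bool" where
  "C2_bounded V \<longleftrightarrow>
     (\<forall>i. has_partial_deriv i V) \<and>
     (\<forall>i j. has_partial_deriv j (partial_deriv i V) \<and>
            continuous_on UNIV (partial_deriv j (partial_deriv i V)) \<and>
            bounded (range (partial_deriv j (partial_deriv i V))))"


section \<open>The recursion\<close>

text \<open>The norm of the type \<open>real^'m^'m\<close> is not the induced operator norm, hence this definition.\<close>

definition op_norm :: "real^'m::finite^'m \<Rightarrow> real" where
  "op_norm A = onorm (\<lambda>x. A *v x)"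

primrec estimator ::
    "(nat \<Rightarrow> 'w \<Rightarrow> 'x) \<Rightarrow> (nat \<Rightarrow> real^'m \<Rightarrow> (nat \<Rightarrow> 'x) \<Rightarrow> real^'m^'m) \<Rightarrow>
     (nat \<Rightarrow> real^'m \<Rightarrow> (nat \<Rightarrow> 'x) \<Rightarrow> real^'m) \<Rightarrow> real^'m::finite \<Rightarrow> nat \<Rightarrow> 'w \<Rightarrow> real^'m" where
  "estimator X \<Gamma> \<psi> \<theta>0 0 \<omega> = \<theta>0"
| "estimator X \<Gamma> \<psi> \<theta>0 (Suc t) \<omega> =
     estimator X \<Gamma> \<psi> \<theta>0 t \<omega> +
     matrix_inv (\<Gamma> (Suc t) (estimator X \<Gamma> \<psi> \<theta>0 t \<omega>) (hist X t \<omega>)) *v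
       \<psi> (Suc t) (estimator X \<Gamma> \<psi> \<theta>0 t \<omega>) (hist X (Suc t) \<omega>)"

text \<open>\<open>\<N>\<^sub>t(u)\<close> as a function of the past \<open>h\<close>; the random variable is obtained at
  \<open>h = hist X (t - 1) \<omega>\<close>.\<close>

definition drift ::
    "'x measure \<Rightarrow> (nat \<Rightarrow> real^'m \<Rightarrow> 'x \<Rightarrow> (nat \<Rightarrow> 'x) \<Rightarrow> real) \<Rightarrow>
     (nat \<Rightarrow> real^'m \<Rightarrow> (nat \<Rightarrow> 'x) \<Rightarrow> real^'m^'m) \<Rightarrow>
     (nat \<Rightarrow> real^'m \<Rightarrow> (nat \<Rightarrow> 'x) \<Rightarrow> real^'m) \<Rightarrow>
     (real^'m::finite \<Rightarrow> real) \<Rightarrow> real^'m \<Rightarrow> nat \<Rightarrow> real^'m \<Rightarrow> (nat \<Rightarrow> 'x) \<Rightarrow> real" where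
  "drift \<mu> f \<Gamma> \<psi> V \<theta> t u h =
     gradient V u \<bullet> (matrix_inv (\<Gamma> t (\<theta> + u) h) *v cond_mean \<mu> (f t \<theta>) t (\<psi> t (\<theta> + u)) h)
     + 1 / 2 * (SUP v. op_norm (hessian V v)) *
       cond_mean \<mu> (f t \<theta>) t (\<lambda>x. (norm (matrix_inv (\<Gamma> t (\<theta> + u) h) *v \<psi> t (\<theta> + u) x))\<^sup>2) h"

end

theory Submission
  imports Defs
begin

text \<open>The function \<open>V\<close> serves as a stochastic Lyapunov function. By Taylor's formula and the bound on the
  second derivatives (\<open>taylor_upper_bound\<close>), the conditional mean of \<open>V (\<Delta> (t + 1))\<close> given the
  observations up to time \<open>t\<close> is at most \<open>V (\<Delta> t) + \<N>\<close>, where \<open>\<N>\<close> is the drift at \<open>\<Delta> t\<close>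
  (\<open>integral_taylor_drift\<close>). Writing the positive part of the drift as \<open>\<beta> t * (1 + V (\<Delta> t))\<close> shows that
  \<open>Y t = 1 + V (\<Delta> t)\<close> is an almost supermartingale: the conditional mean of \<open>Y (t + 1)\<close> is at most
  \<open>(1 + \<beta> t) * Y t - \<zeta> t\<close>, with \<open>\<zeta> t\<close> the negative part of the drift. The hypothesis on the positive part
  says that \<open>\<beta>\<close> is summable almost surely, so by the theorem of Robbins and Siegmund
  (\<open>Robbins_Siegmund\<close>) \<open>V (\<Delta> t)\<close> converges and \<open>\<zeta>\<close> is summable.

  The limit must be \<open>0\<close> on \<open>A\<close>: if it were positive, then \<open>V (\<Delta> t)\<close> would eventually stay in some
  interval \<open>[\<epsilon>, 1 / \<epsilon>]\<close>, and \<open>\<zeta> t\<close> would dominate the infimum of the negative part of the drift over this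
  region, whose sum diverges (\<open>limit_zero_if_sum_diverges\<close>). Since \<open>V\<close> is bounded away from \<open>0\<close> off each
  neighbourhood of the origin, \<open>\<Delta> t\<close> tends to \<open>0\<close>.

  The theorem of Robbins and Siegmund rests on the convergence of nonnegative supermartingales,
  obtained from Doob's upcrossing argument (\<open>supermartingale_convergence\<close>). The passage from the
  conditional densities, which are tied to conditional probabilities of events only, to conditional
  expectations of functions of the past and the next observation is
  \<open>nn_cond_exp_conditional_density\<close>.\<close>

section \<open>Functions with bounded second partial derivatives\<close>

lemma partial_deriv_along_axis:
  assumes "has_partial_deriv i g"
  shows "((\<lambda>s. g (u + s *\<^sub>R axis i 1)) has_real_derivative
           partial_deriv i g (u + s *\<^sub>R axis i 1)) (at s)"
proof -
  have "((\<lambda>r. g ((u + s *\<^sub>R axis i 1) + r *\<^sub>R axis i 1)) has_real_derivative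
           partial_deriv i g (u + s *\<^sub>R axis i 1)) (at 0)"
    using assms unfolding has_partial_deriv_def partial_deriv_def
    by (intro field_differentiable_derivI) blast
  then have "((\<lambda>r. g (u + (r + s) *\<^sub>R axis i 1)) has_real_derivative
           partial_deriv i g (u + s *\<^sub>R axis i 1)) (at 0)"
    by (simp add: algebra_simps)
  then show ?thesis
    using DERIV_shift[of "\<lambda>s. g (u + s *\<^sub>R axis i 1)" _ 0 s] by simp
qed

text \<open>Continuity of the partial derivatives is what upgrades them to a total derivative: the
  increment along \<open>h\<close> is split into steps parallel to the axes, and the mean value inequality
  controls each step by the oscillation of one partial derivative near \<open>x\<close>.\<close>

lemma has_derivative_gradient:
  fixes g :: "real^'m::finite \<Rightarrow> real"
  assumes pd: "\<And>i. has_partial_deriv i g"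
    and cont: "\<And>i. continuous_on UNIV (partial_deriv i g)"
  shows "(g has_derivative (\<lambda>h. gradient g x \<bullet> h)) (at x)"
  unfolding has_derivative_at_alt
proof (intro conjI allI impI)
  show "bounded_linear (\<lambda>h. gradient g x \<bullet> h)" by (rule bounded_linear_inner_right)
next
  fix e :: real assume "0 < e"
  \<comment> \<open>Each of the \<open>CARD('m)\<close> steps may contribute an error of \<open>e' * norm h\<close>.\<close>
  define e' where "e' = e / CARD('m)"
  have e': "0 < e'" using \<open>0 < e\<close> by (simp add: e'_def)
  have "\<exists>d>0. \<forall>y. dist y x < d \<longrightarrow> dist (partial_deriv i g y) (partial_deriv i g x) < e'" for i
    using cont[of i] e' unfolding continuous_on_iff by (metis UNIV_I)
  then obtain d where d: "\<And>i. d i > 0"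
    "\<And>i y. dist y x < d i \<Longrightarrow> dist (partial_deriv i g y) (partial_deriv i g x) < e'"
    by metis
  define D where "D = Min (range d)"
  have D: "D > 0" "\<And>i. D \<le> d i" using d(1) by (auto simp: D_def)
  have near: "\<bar>partial_deriv i g y - partial_deriv i g x\<bar> \<le> e'" if "norm (y - x) < D" for i y
    using d(2)[of y i] D(2)[of i] that by (simp add: dist_norm)
  \<comment> \<open>Moving the coordinates in \<open>S\<close> one after the other; every intermediate point stays
     within \<open>norm h\<close> of \<open>x\<close>.\<close>
  have main: "\<bar>g (x + (\<Sum>i\<in>S. h$i *\<^sub>R axis i 1)) - g x - (\<Sum>i\<in>S. h$i * partial_deriv i g x)\<bar>
      \<le> card S * e' * norm h" if "norm h < D" for h :: "real^'m" and S :: "'m set"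
  proof -
    have "finite S" by simp
    then show ?thesis
    proof (induction S)
      case empty then show ?case by simp
    next
      case (insert k S)
      define y where "y = x + (\<Sum>i\<in>S. h$i *\<^sub>R axis i 1)"
      define \<phi> where "\<phi> = (\<lambda>s. g (y + s *\<^sub>R axis k 1) - s * partial_deriv k g x)"
      have small: "norm (y + s *\<^sub>R axis k 1 - x) \<le> norm h" if "\<bar>s\<bar> \<le> \<bar>h$k\<bar>" for s
      proof -
        have "norm ((y + s *\<^sub>R axis k 1 - x) $ j) \<le> norm (h $ j)" for j
        proof -
          have "(\<Sum>i\<in>S. h$i * axis i 1 $ j) = (if j \<in> S then h$j else 0)"
            by (simp add: axis_def if_distrib[of "\<lambda>a. _ * a"] sum.delta cong: if_cong)
          then show ?thesis using that insert(2)
            by (auto simp: y_def axis_def)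
        qed
        then show ?thesis by (rule norm_le_componentwise_cart)
      qed
      have "norm (\<phi> (h$k) - \<phi> 0) \<le> e' * norm (h$k - 0)"
      proof (rule field_differentiable_bound[of "{- \<bar>h$k\<bar>..\<bar>h$k\<bar>}" \<phi>
              "\<lambda>s. partial_deriv k g (y + s *\<^sub>R axis k 1) - partial_deriv k g x"])
        fix z assume z: "z \<in> {- \<bar>h$k\<bar>..\<bar>h$k\<bar>}"
        have "(\<phi> has_real_derivative partial_deriv k g (y + z *\<^sub>R axis k 1) - 1 * partial_deriv k g x) (at z)"
          unfolding \<phi>_def by (intro DERIV_diff partial_deriv_along_axis pd DERIV_cmult_right DERIV_ident)
        then show "(\<phi> has_real_derivative partial_deriv k g (y + z *\<^sub>R axis k 1) - partial_deriv k g x)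
              (at z within {- \<bar>h$k\<bar>..\<bar>h$k\<bar>})"
          by (simp add: has_field_derivative_at_within)
        show "norm (partial_deriv k g (y + z *\<^sub>R axis k 1) - partial_deriv k g x) \<le> e'"
        proof -
          have "norm (y + z *\<^sub>R axis k 1 - x) < D"
            using small[of z] z \<open>norm h < D\<close> by (auto simp: abs_le_iff)
          from near[OF this] show ?thesis by simp
        qed
      qed auto
      then have "\<bar>g (y + h$k *\<^sub>R axis k 1) - g y - h$k * partial_deriv k g x\<bar> \<le> e' * norm h"
        using mult_left_mono[OF component_le_norm_cart[of h k] less_imp_le[OF e']]
        by (simp add: \<phi>_def algebra_simps)
      moreover have "\<bar>g y - g x - (\<Sum>i\<in>S. h$i * partial_deriv i g x)\<bar> \<le> card S * e' * norm h"
        using insert by (simp add: y_def)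
      ultimately show ?case
        using insert(1,2) by (simp add: y_def algebra_simps)
    qed
  qed
  show "\<exists>d>0. \<forall>y. norm (y - x) < d \<longrightarrow>
      norm (g y - g x - gradient g x \<bullet> (y - x)) \<le> e * norm (y - x)"
  proof (intro exI[of _ D] conjI allI impI D)
    fix y assume "norm (y - x) < D"
    from main[OF this, of UNIV]
    have "\<bar>g (x + (y - x)) - g x - (\<Sum>i\<in>UNIV. (y - x)$i * partial_deriv i g x)\<bar> \<le> e * norm (y - x)"
      using basis_expansion[of "y - x"] by (simp add: e'_def scalar_mult_eq_scaleR)
    then show "norm (g y - g x - gradient g x \<bullet> (y - x)) \<le> e * norm (y - x)"
      by (simp add: inner_vec_def gradient_def mult.commute)
  qed
qed

text \<open>A supremum in \<open>\<real>\<close> bounds its members only when the set is bounded above, so this is what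
  gives the supremum in the drift its meaning.\<close>

lemma op_norm_hessian_bdd_above:
  fixes V :: "real^'m::finite \<Rightarrow> real"
  assumes "C2_bounded V"
  shows "bdd_above (range (\<lambda>v. op_norm (hessian V v)))"
proof -
  have "\<forall>i j. \<exists>B. \<forall>v. \<bar>partial_deriv j (partial_deriv i V) v\<bar> \<le> B"
    using assms unfolding C2_bounded_def bounded_iff by fastforce
  then obtain B where B: "\<And>i j v. \<bar>partial_deriv j (partial_deriv i V) v\<bar> \<le> B i j"
    unfolding choice_iff by blast
  define K where "K = Max (range (\<lambda>(i, j). B i j))"
  have BK: "B i j \<le> K" for i j unfolding K_def by (rule Max_ge) auto
  have "op_norm (hessian V v) \<le> real CARD('m) * real CARD('m) * K" for v
    unfolding op_norm_def
    by (rule onorm_le_matrix_component) (auto simp: hessian_def intro: order_trans[OF B BK])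
  then show ?thesis by (intro bdd_aboveI) blast
qed

context
  fixes V :: "real^'m::finite \<Rightarrow> real"
  assumes C2: "C2_bounded V"
begin

lemma has_derivative_partial_deriv:
  "(partial_deriv i V has_derivative (\<lambda>h. gradient (partial_deriv i V) u \<bullet> h)) (at u)"
  using C2 unfolding C2_bounded_def by (intro has_derivative_gradient) auto

lemma continuous_on_partial_deriv: "continuous_on UNIV (partial_deriv i V)"
  using has_derivative_continuous[OF has_derivative_partial_deriv]
  by (auto simp: continuous_on_eq_continuous_within)

lemma has_derivative_C2: "(V has_derivative (\<lambda>h. gradient V u \<bullet> h)) (at u)"
  using C2 continuous_on_partial_deriv unfolding C2_bounded_def
  by (intro has_derivative_gradient) auto

lemma continuous_on_C2: "continuous_on UNIV V"
  using has_derivative_continuous[OF has_derivative_C2]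
  by (auto simp: continuous_on_eq_continuous_within)

lemma continuous_on_gradient: "continuous_on UNIV (gradient V)"
  unfolding gradient_def by (intro continuous_on_vec_lambda continuous_on_partial_deriv)

text \<open>Taylor's formula of order two along the segment from \<open>u\<close> to \<open>u + w\<close>. The remainder is the quadratic
  form of the Hessian at \<open>w\<close>, which the operator norm dominates.\<close>

lemma taylor_upper_bound:
  "V (u + w) \<le> V u + gradient V u \<bullet> w + 1 / 2 * (SUP v. op_norm (hessian V v)) * (norm w)\<^sup>2"
proof -
  define K where "K = (SUP v. op_norm (hessian V v))"
  define diff where "diff = (\<lambda>m::nat. \<lambda>s::real.
     if m = 0 then V (u + s *\<^sub>R w) else if m = 1 then gradient V (u + s *\<^sub>R w) \<bullet> w
     else w \<bullet> (hessian V (u + s *\<^sub>R w) *v w))"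
  have line: "((\<lambda>s. u + s *\<^sub>R w) has_derivative (\<lambda>r. r *\<^sub>R w)) (at s)" for s
    by (auto intro!: derivative_eq_intros)
  have d0: "(diff 0 has_real_derivative diff 1 s) (at s)" for s
    using has_derivative_imp_has_field_derivative[OF has_derivative_compose[OF line has_derivative_C2]]
    unfolding diff_def by simp
  have "((\<lambda>s. partial_deriv i V (u + s *\<^sub>R w)) has_real_derivative
      gradient (partial_deriv i V) (u + s *\<^sub>R w) \<bullet> w) (at s)" for i s
    using has_derivative_imp_has_field_derivative[OF has_derivative_compose[OF line has_derivative_partial_deriv]]
    by simp
  then have "((\<lambda>s. \<Sum>i\<in>UNIV. partial_deriv i V (u + s *\<^sub>R w) * w$i) has_real_derivative
      (\<Sum>i\<in>UNIV. gradient (partial_deriv i V) (u + s *\<^sub>R w) \<bullet> w * w$i)) (at s)" for s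
    by (intro DERIV_sum DERIV_cmult_right)
  then have d1: "(diff 1 has_real_derivative diff 2 s) (at s)" for s
    unfolding diff_def
    by (simp add: inner_vec_def gradient_def hessian_def matrix_vector_mult_def mult.commute)
  have "\<exists>t>0. t < 1 \<and> diff 0 1 = (\<Sum>m<2. diff m 0 / fact m * 1 ^ m) + diff 2 t / fact 2 * 1\<^sup>2"
  proof (rule Maclaurin)
    show "\<forall>m t. m < 2 \<and> 0 \<le> t \<and> t \<le> 1 \<longrightarrow> (diff m has_real_derivative diff (Suc m) t) (at t)"
    proof (intro allI impI)
      fix m :: nat and t :: real assume "m < 2 \<and> 0 \<le> t \<and> t \<le> 1"
      then consider "m = 0" | "m = 1" by linarith
      then show "(diff m has_real_derivative diff (Suc m) t) (at t)"
        using d0[of t] d1[of t] by cases (simp_all add: numeral_2_eq_2)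
    qed
  qed auto
  then obtain t where t: "diff 0 1 = diff 0 0 + diff 1 0 + diff 2 t / 2"
    by (auto simp: numeral_2_eq_2)
  have "diff 2 t \<le> norm w * norm (hessian V (u + t *\<^sub>R w) *v w)"
    unfolding diff_def by (simp add: norm_cauchy_schwarz)
  also have "\<dots> \<le> norm w * (op_norm (hessian V (u + t *\<^sub>R w)) * norm w)"
    unfolding op_norm_def by (intro mult_left_mono onorm) auto
  also have "\<dots> \<le> norm w * (K * norm w)"
    unfolding K_def
    by (intro mult_left_mono mult_right_mono cSUP_upper op_norm_hessian_bdd_above[OF C2]) auto
  finally show ?thesis using t
    unfolding K_def[symmetric] by (simp add: diff_def power2_eq_square algebra_simps)
qed

end

section \<open>Measurability of matrix inversion\<close>

lemma borel_measurable_vec_lambda: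
  fixes f :: "'a \<Rightarrow> 'n::finite \<Rightarrow> 'b::euclidean_space"
  assumes "\<And>i. (\<lambda>x. f x i) \<in> borel_measurable M"
  shows "(\<lambda>x. \<chi> i. f x i) \<in> borel_measurable M"
proof (rule borel_measurable_euclidean_space[THEN iffD2], rule ballI)
  fix b :: "'b^'n" assume "b \<in> Basis"
  then obtain i u where "b = axis i u" by (auto simp: Basis_vec_def)
  then show "(\<lambda>x. (\<chi> i. f x i) \<bullet> b) \<in> borel_measurable M"
    using borel_measurable_inner[OF assms borel_measurable_const, of i u] by (simp add: inner_axis)
qed

text \<open>The inverse is chosen by Hilbert's operator. On singular matrices the choice ranges over the empty
  predicate and hence is one fixed matrix; elsewhere Cramer's rule writes the entries as rational
  functions. Both pieces are visibly measurable.\<close>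

lemma matrix_inv_cramer:
  fixes A :: "real^'m^'m::finite"
  shows "matrix_inv A =
    (if det A = 0 then (SOME B. False)
     else (\<chi> k j. det (\<chi> i l. if l = k then axis j 1 $ i else A$i$l) / det A))"
proof (cases "det A = 0")
  case True
  then have "(\<lambda>B. A ** B = mat 1 \<and> B ** A = mat 1) = (\<lambda>B. False)"
    using invertible_det_nz[of A] unfolding invertible_def by blast
  then show ?thesis using True unfolding matrix_inv_def by simp
next
  case False
  then have inv: "A ** matrix_inv A = mat 1"
    using invertible_det_nz[of A] unfolding matrix_inv_def invertible_def
    by (metis (mono_tags, lifting) someI_ex)
  have "matrix_inv A $ k $ j = det (\<chi> i l. if l = k then axis j 1 $ i else A$i$l) / det A" for k j
  proof -
    have "A *v (matrix_inv A *v axis j 1) = axis j 1"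
      by (simp add: matrix_vector_mul_assoc inv)
    then have *: "matrix_inv A *v axis j 1 = (\<chi> k. det (\<chi> i l. if l = k then axis j 1 $ i else A$i$l) / det A)"
      by (rule cramer[OF False, THEN iffD1])
    have "matrix_inv A $ k $ j = (matrix_inv A *v axis j 1) $ k"
      by (simp add: matrix_vector_mult_basis column_def)
    then show ?thesis unfolding * by simp
  qed
  then show ?thesis using False by (simp add: vec_eq_iff)
qed

lemma borel_measurable_matrix_entry [measurable (raw)]:
  fixes A :: "'a \<Rightarrow> real^'m^'n::finite"
  assumes "A \<in> borel_measurable M"
  shows "(\<lambda>x. A x $ i $ j) \<in> borel_measurable M"
proof -
  have "(\<lambda>A::real^'m^'n. A $ i $ j) \<in> borel_measurable borel"
    by (intro borel_measurable_continuous_onI continuous_intros)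
  from measurable_compose[OF assms this] show ?thesis .
qed

lemma borel_measurable_det [measurable (raw)]:
  fixes A :: "'a \<Rightarrow> 'm \<Rightarrow> 'm::finite \<Rightarrow> real"
  assumes "\<And>i j. (\<lambda>x. A x i j) \<in> borel_measurable M"
  shows "(\<lambda>x. det (\<chi> i j. A x i j)) \<in> borel_measurable M"
  unfolding det_def vec_lambda_beta
  by (intro borel_measurable_sum borel_measurable_times borel_measurable_prod borel_measurable_const assms)

lemma borel_measurable_matrix_inv [measurable]:
  "(matrix_inv :: real^'m^'m::finite \<Rightarrow> real^'m^'m) \<in> borel_measurable borel"
proof -
  have [measurable]: "(\<lambda>A::real^'m^'m. det A) \<in> borel_measurable borel"
    using borel_measurable_det[of "\<lambda>A i j. A $ i $ j" borel] by simp
  have [measurable]: "(\<lambda>A::real^'m^'m. if l = k then axis j 1 $ i else A $ i $ l) \<in> borel_measurable borel"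
    for i j k l by (cases "l = k") simp_all
  show ?thesis
    unfolding matrix_inv_cramer
    by (intro measurable_If borel_measurable_const borel_measurable_vec_lambda
        borel_measurable_divide borel_measurable_det) measurable
qed

lemma borel_measurable_matrix_vector_mult [measurable (raw)]:
  fixes A :: "'a \<Rightarrow> real^'m^'n::finite"
  assumes [measurable]: "A \<in> borel_measurable M" "b \<in> borel_measurable M"
  shows "(\<lambda>x. A x *v b x) \<in> borel_measurable M"
  unfolding matrix_vector_mult_def
  by (intro borel_measurable_vec_lambda borel_measurable_sum borel_measurable_times
      borel_measurable_matrix_entry measurable_compose[OF _ borel_measurable_nth] assms)

section \<open>Convergence of supermartingales and almost supermartingales\<close>

text \<open>The state of a trader who buys at a price of at most \<open>a\<close> and sells at a price of at least \<open>b\<close>: whether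
  the asset is held at time \<open>t\<close>, and the number of sales so far, which is the number of upcrossings of
  \<open>[a, b]\<close>.\<close>

primrec crossing :: "real \<Rightarrow> real \<Rightarrow> (nat \<Rightarrow> real) \<Rightarrow> nat \<Rightarrow> bool \<times> nat" where
  "crossing a b u 0 = (u 0 \<le> a, 0)"
| "crossing a b u (Suc t) =
     (if fst (crossing a b u t)
      then (if b \<le> u (Suc t) then (False, Suc (snd (crossing a b u t)))
            else (True, snd (crossing a b u t)))
      else (u (Suc t) \<le> a, snd (crossing a b u t)))"

text \<open>A lower bound for the wealth of this trader who starts with \<open>a\<close>: each completed crossing contributes
  \<open>b - a\<close>, and the amount \<open>a\<close> is replaced by the current price while the asset is held. Unlike the
  accumulated gain it is nonnegative, so its expectation can be handled by nonnegative integrals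
  throughout.\<close>

definition crossing_potential :: "real \<Rightarrow> real \<Rightarrow> (nat \<Rightarrow> real) \<Rightarrow> nat \<Rightarrow> real" where
  "crossing_potential a b u t =
     (b - a) * real (snd (crossing a b u t)) + (if fst (crossing a b u t) then u t else a)"

lemma crossing_potential_nonneg:
  assumes "0 \<le> a" "a < b" "\<And>t. 0 \<le> u t"
  shows "0 \<le> crossing_potential a b u t"
  using assms by (simp add: crossing_potential_def)

lemma crossing_count_le_potential:
  assumes "0 \<le> a" "\<And>t. 0 \<le> u t"
  shows "(b - a) * real (snd (crossing a b u t)) \<le> crossing_potential a b u t"
  using assms by (simp add: crossing_potential_def)

text \<open>The potential grows at most by the price change of a held asset: buying replaces \<open>a\<close> by a price
  of at most \<open>a\<close>, and a sale at a price of at least \<open>b\<close> is credited with \<open>b\<close> only. The two sides are kept free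
  of subtractions in order to integrate them in \<open>ennreal\<close>.\<close>

lemma crossing_potential_step:
  assumes "a < b"
  shows "crossing_potential a b u (Suc t) + (if fst (crossing a b u t) then u t else 0)
       \<le> crossing_potential a b u t + (if fst (crossing a b u t) then u (Suc t) else 0)"
  using assms by (auto simp: crossing_potential_def algebra_simps)

lemma crossing_count_mono: "s \<le> t \<Longrightarrow> snd (crossing a b u s) \<le> snd (crossing a b u t)"
  by (rule lift_Suc_mono_le[of "\<lambda>t. snd (crossing a b u t)"]) auto

lemma crossing_kept:
  "fst (crossing a b u t) \<Longrightarrow>
     fst (crossing a b u (t + n)) \<or> snd (crossing a b u t) < snd (crossing a b u (t + n))"
  by (induction n) (auto simp: less_Suc_eq_le intro: crossing_count_mono)

text \<open>An oscillating price makes the trader buy after any time, and then sell.\<close>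

lemma crossing_count_unbounded:
  assumes low: "\<exists>\<^sub>F t in sequentially. u t \<le> a" and high: "\<exists>\<^sub>F t in sequentially. b \<le> u t"
  shows "\<exists>t. k \<le> snd (crossing a b u t)"
proof (induction k)
  case 0 then show ?case by simp
next
  case (Suc k)
  then obtain t where t: "k \<le> snd (crossing a b u t)" by blast
  from low obtain s where s: "s > t" "u s \<le> a"
    unfolding frequently_sequentially by (metis Suc_le_eq)
  then obtain s' where s': "s = Suc s'" "t \<le> s'" by (cases s) auto
  have "\<exists>r\<ge>t. fst (crossing a b u r)"
    using s s' by (cases "fst (crossing a b u s')") (auto intro: exI[of _ s'] exI[of _ s])
  then obtain r where r: "r \<ge> t" "fst (crossing a b u r)" by blast
  from high obtain q where q: "q > r" "b \<le> u q"
    unfolding frequently_sequentially by (metis Suc_le_eq)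
  then obtain n where n: "q = Suc (r + n)" using less_imp_Suc_add by blast
  have "snd (crossing a b u r) < snd (crossing a b u q)"
    using crossing_kept[OF r(2), of n] q(2) crossing_count_mono[of r "r + n" a b u]
    unfolding n by (auto simp: less_Suc_eq_le)
  then show ?case
    using t crossing_count_mono[OF r(1), of a b u] by (intro exI[of _ q]) linarith
qed

text \<open>A filtration indexed by the natural numbers, phrased with \<open>subalgebra\<close> so that the theory of
  conditional expectations applies to each member.\<close>

locale discrete_filtration = prob_space M for M :: "'a measure" +
  fixes F :: "nat \<Rightarrow> 'a measure"
  assumes subalg: "\<And>t. subalgebra M (F t)"
    and mono: "\<And>t. subalgebra (F (Suc t)) (F t)"
begin

lemma finite_measure_subalgebra_F: "finite_measure_subalgebra M (F t)"
  by unfold_locales (rule subalg)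

lemmas measurable_F_M = measurable_from_subalg[OF subalg]
lemmas measurable_F_Suc = measurable_from_subalg[OF mono]

lemma measurable_F_mono:
  assumes "f \<in> measurable (F s) N" "s \<le> t"
  shows "f \<in> measurable (F t) N"
  using assms(2,1) by (induction rule: dec_induct) (auto intro: measurable_F_Suc)

context
  fixes U :: "nat \<Rightarrow> 'a \<Rightarrow> real"
  assumes adapted: "\<And>t. U t \<in> borel_measurable (F t)"
    and nonneg: "\<And>t x. 0 \<le> U t x"
    and finite_start: "(\<integral>\<^sup>+x. U 0 x \<partial>M) < \<infinity>"
    and super: "\<And>t. AE x in M. nn_cond_exp M (F t) (\<lambda>x. ennreal (U (Suc t) x)) x \<le> U t x"
begin

lemma supermartingale_set_integral:
  assumes A: "A \<in> sets (F t)"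
  shows "(\<integral>\<^sup>+x\<in>A. U (Suc t) x \<partial>M) \<le> (\<integral>\<^sup>+x\<in>A. U t x \<partial>M)"
proof -
  interpret S: finite_measure_subalgebra M "F t" by (rule finite_measure_subalgebra_F)
  have [measurable]: "U t \<in> borel_measurable M" for t by (rule measurable_F_M[OF adapted])
  have "(\<integral>\<^sup>+x\<in>A. U (Suc t) x \<partial>M) = (\<integral>\<^sup>+x. indicator A x * nn_cond_exp M (F t) (\<lambda>x. ennreal (U (Suc t) x)) x \<partial>M)"
    using A by (subst S.nn_cond_exp_intg) (auto simp: mult.commute)
  also have "\<dots> \<le> (\<integral>\<^sup>+x\<in>A. U t x \<partial>M)"
    using super[of t] by (intro nn_integral_mono_AE) (auto simp: mult.commute intro: mult_left_mono elim!: eventually_mono)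
  finally show ?thesis .
qed

lemma supermartingale_integral_le: "(\<integral>\<^sup>+x. U t x \<partial>M) \<le> (\<integral>\<^sup>+x. U 0 x \<partial>M)"
proof (induction t)
  case (Suc t)
  have *: "(\<integral>\<^sup>+x\<in>space M. U t x \<partial>M) = (\<integral>\<^sup>+x. U t x \<partial>M)" for t
    by (rule nn_integral_cong) simp
  have "(\<integral>\<^sup>+x\<in>space M. U (Suc t) x \<partial>M) \<le> (\<integral>\<^sup>+x\<in>space M. U t x \<partial>M)"
    using subalg[of t] sets.top[of "F t"] by (intro supermartingale_set_integral) (simp add: subalgebra_def)
  then show ?case using Suc unfolding * by order
qed simp

lemma crossing_measurable:
  "(\<lambda>x. fst (crossing a b (\<lambda>t. U t x) t)) \<in> measurable (F t) (count_space UNIV)"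
  "(\<lambda>x. snd (crossing a b (\<lambda>t. U t x) t)) \<in> measurable (F t) (count_space UNIV)"
proof (induction t)
  case 0
  note [measurable] = adapted[of 0]
  { case 1 show ?case by simp }
  { case 2 show ?case by simp }
next
  case (Suc t)
  note [measurable] = adapted[of "Suc t"] measurable_F_Suc[OF Suc(1)] measurable_F_Suc[OF Suc(2)]
  { case 1 show ?case unfolding crossing.simps if_distrib[of fst] fst_conv by measurable }
  { case 2 show ?case unfolding crossing.simps if_distrib[of snd] snd_conv by measurable }
qed

text \<open>Whether the asset is held at time \<open>t\<close> is decided by the past, so the supermartingale inequality
  applies on that event and trading cannot increase the expected potential.\<close>

lemma crossing_potential_integral_le:
  assumes ab: "0 \<le> a" "a < b"
  shows "(\<integral>\<^sup>+x. crossing_potential a b (\<lambda>t. U t x) t \<partial>M) \<le> ennreal a"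
proof (induction t)
  case 0
  have "(\<integral>\<^sup>+x. crossing_potential a b (\<lambda>t. U t x) 0 \<partial>M) \<le> (\<integral>\<^sup>+x. ennreal a \<partial>M)"
    using nonneg by (intro nn_integral_mono ennreal_leI) (simp add: crossing_potential_def)
  then show ?case by (simp add: emeasure_space_1)
next
  case (Suc t)
  let ?H = "{x \<in> space M. fst (crossing a b (\<lambda>t. U t x) t)}"
  have H: "?H \<in> sets (F t)"
    using measurable_sets[OF crossing_measurable(1)[of a b t], of "{True}"] subalg[of t]
    by (auto simp: subalgebra_def vimage_def Int_def conj_commute)
  have [measurable]: "?H \<in> sets M" using H subalg[of t] by (auto simp: subalgebra_def)
  note [measurable] = measurable_F_M[OF adapted] measurable_F_M[OF crossing_measurable(1)]
    measurable_F_M[OF crossing_measurable(2)]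
  have [measurable]: "(\<lambda>x. crossing_potential a b (\<lambda>t. U t x) s) \<in> borel_measurable M" for s
    unfolding crossing_potential_def by measurable
  have pot: "0 \<le> crossing_potential a b (\<lambda>t. U t x) s" for x s
    by (rule crossing_potential_nonneg[OF ab nonneg])
  let ?p = "\<lambda>s. \<integral>\<^sup>+x. crossing_potential a b (\<lambda>t. U t x) s \<partial>M"
  have fin: "(\<integral>\<^sup>+x\<in>?H. U t x \<partial>M) < \<infinity>"
    by (rule le_less_trans[OF _ le_less_trans[OF supermartingale_integral_le finite_start]])
       (auto intro!: nn_integral_mono simp: indicator_def)
  have "?p (Suc t) + (\<integral>\<^sup>+x\<in>?H. U t x \<partial>M)
      = (\<integral>\<^sup>+x. crossing_potential a b (\<lambda>t. U t x) (Suc t) + ennreal (U t x) * indicator ?H x \<partial>M)"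
    by (rule nn_integral_add[symmetric]) measurable
  also have "\<dots> \<le> (\<integral>\<^sup>+x. crossing_potential a b (\<lambda>t. U t x) t + ennreal (U (Suc t) x) * indicator ?H x \<partial>M)"
  proof (rule nn_integral_mono)
    fix x assume "x \<in> space M"
    then show "ennreal (crossing_potential a b (\<lambda>t. U t x) (Suc t)) + ennreal (U t x) * indicator ?H x
      \<le> ennreal (crossing_potential a b (\<lambda>t. U t x) t) + ennreal (U (Suc t) x) * indicator ?H x"
      using crossing_potential_step[OF ab(2), of "\<lambda>t. U t x" t] nonneg pot[of x t] pot[of x "Suc t"]
      by (auto simp: indicator_def ennreal_plus[symmetric] simp del: ennreal_plus intro!: ennreal_leI)
  qed
  also have "\<dots> = ?p t + (\<integral>\<^sup>+x\<in>?H. U (Suc t) x \<partial>M)"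
    by (rule nn_integral_add) measurable
  also have "\<dots> \<le> ?p t + (\<integral>\<^sup>+x\<in>?H. U t x \<partial>M)"
    by (intro add_left_mono supermartingale_set_integral H)
  finally have "?p (Suc t) \<le> ?p t"
    \<comment> \<open>The common term may be cancelled because it is finite.\<close>
    using fin by (auto simp: ennreal_add_left_cancel_le add.commute[of _ "\<integral>\<^sup>+x\<in>_. _ x \<partial>M"])
  then show ?case using Suc by order
qed

text \<open>Doob's upcrossing inequality: the expected number of crossings up to any time is at most
  \<open>a / (b - a)\<close>, hence so is the expectation of the total number.\<close>

lemma AE_finitely_many_crossings:
  assumes ab: "0 \<le> a" "a < b"
  shows "AE x in M. \<not> ((\<exists>\<^sub>F t in sequentially. U t x \<le> a) \<and> (\<exists>\<^sub>F t in sequentially. b \<le> U t x))"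
proof -
  let ?c = "\<lambda>t x. ennreal (real (snd (crossing a b (\<lambda>t. U t x) t)))"
  note [measurable] = measurable_F_M[OF crossing_measurable(2)]
  have "(\<integral>\<^sup>+x. (SUP t. ?c t x) \<partial>M) = (SUP t. \<integral>\<^sup>+x. ?c t x \<partial>M)"
    by (rule nn_integral_monotone_convergence_SUP)
       (auto simp: incseq_def le_fun_def intro!: ennreal_leI crossing_count_mono)
  also have "\<dots> \<le> ennreal (a / (b - a))"
  proof (rule SUP_least)
    fix t
    have "ennreal (b - a) * (\<integral>\<^sup>+x. ?c t x \<partial>M) = (\<integral>\<^sup>+x. ennreal ((b - a) * real (snd (crossing a b (\<lambda>t. U t x) t))) \<partial>M)"
      using ab by (subst nn_integral_cmult[symmetric]) (auto simp: ennreal_mult)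
    also have "\<dots> \<le> (\<integral>\<^sup>+x. crossing_potential a b (\<lambda>t. U t x) t \<partial>M)"
      by (intro nn_integral_mono ennreal_leI crossing_count_le_potential ab nonneg)
    also have "\<dots> \<le> ennreal a" by (rule crossing_potential_integral_le[OF ab])
    finally have *: "ennreal (b - a) * (\<integral>\<^sup>+x. ?c t x \<partial>M) \<le> ennreal a" .
    have "(\<integral>\<^sup>+x. ?c t x \<partial>M) = ennreal (1 / (b - a)) * (ennreal (b - a) * (\<integral>\<^sup>+x. ?c t x \<partial>M))"
      using ab by (simp add: mult.assoc[symmetric] ennreal_mult[symmetric])
    also have "\<dots> \<le> ennreal (1 / (b - a)) * ennreal a" by (intro mult_left_mono *) simp
    also have "\<dots> = ennreal (a / (b - a))" using ab by (simp add: ennreal_mult[symmetric])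
    finally show "(\<integral>\<^sup>+x. ?c t x \<partial>M) \<le> ennreal (a / (b - a))" .
  qed
  finally have "(\<integral>\<^sup>+x. (SUP t. ?c t x) \<partial>M) \<noteq> \<infinity>" by (auto simp: top_unique)
  then have "AE x in M. (SUP t. ?c t x) \<noteq> \<infinity>"
    by (intro nn_integral_PInf_AE) auto
  then show ?thesis
  proof (rule AE_mp, intro AE_I2 impI notI)
    fix x assume fin: "(SUP t. ?c t x) \<noteq> \<infinity>"
      and osc: "(\<exists>\<^sub>F t in sequentially. U t x \<le> a) \<and> (\<exists>\<^sub>F t in sequentially. b \<le> U t x)"
    have "of_nat k \<le> (SUP t. ?c t x)" for k
    proof -
      obtain t where "k \<le> snd (crossing a b (\<lambda>t. U t x) t)"
        using crossing_count_unbounded[of "\<lambda>t. U t x"] osc by blast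
      then show ?thesis
        by (intro SUP_upper2[of t]) (auto simp: ennreal_of_nat_eq_real_of_nat intro!: ennreal_leI)
    qed
    then have "(SUP t. ?c t x) = \<infinity>"
      by (metis ennreal_SUP_of_nat_eq_top SUP_least top_unique infinity_ennreal_def)
    then show False using fin by simp
  qed
qed

text \<open>Almost surely no pair of rationals is crossed infinitely often, so the limit exists in
  \<open>[0, \<infinity>]\<close>; Fatou's lemma excludes the value \<open>\<infinity>\<close>.\<close>

theorem supermartingale_convergence: "AE x in M. convergent (\<lambda>t. U t x)"
proof -
  note [measurable] = measurable_F_M[OF adapted]
  have "(\<integral>\<^sup>+x. liminf (\<lambda>t. ennreal (U t x)) \<partial>M) \<le> liminf (\<lambda>t. \<integral>\<^sup>+x. U t x \<partial>M)"
    by (rule nn_integral_liminf) measurable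
  also have "\<dots> \<le> (\<integral>\<^sup>+x. U 0 x \<partial>M)"
    using Liminf_le_Limsup[of sequentially "\<lambda>t. \<integral>\<^sup>+x. U t x \<partial>M"]
      Limsup_bounded[of "\<lambda>t. \<integral>\<^sup>+x. U t x \<partial>M" "\<integral>\<^sup>+x. U 0 x \<partial>M" sequentially]
      supermartingale_integral_le by (auto intro: order_trans)
  finally have "(\<integral>\<^sup>+x. liminf (\<lambda>t. ennreal (U t x)) \<partial>M) \<noteq> \<infinity>" using finite_start by auto
  then have "AE x in M. liminf (\<lambda>t. ennreal (U t x)) \<noteq> \<infinity>"
    by (intro nn_integral_PInf_AE) auto
  moreover have "AE x in M. \<forall>r\<in>{r :: rat \<times> rat. 0 \<le> fst r \<and> fst r < snd r}.
      \<not> ((\<exists>\<^sub>F t in sequentially. U t x \<le> of_rat (fst r)) \<and>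
         (\<exists>\<^sub>F t in sequentially. of_rat (snd r) \<le> U t x))"
  proof (subst AE_ball_countable, simp, intro ballI AE_finitely_many_crossings)
  qed (auto simp: of_rat_less)
  ultimately show ?thesis
  proof eventually_elim
    case (elim x)
    let ?u = "\<lambda>t. ennreal (U t x)"
    have "\<not> liminf ?u < limsup ?u"
    proof
      assume "liminf ?u < limsup ?u"
      then obtain q where q: "liminf ?u < ennreal (of_rat q)" "ennreal (of_rat q) < limsup ?u"
        using ennreal_rat_dense by blast
      then obtain p where p: "liminf ?u < ennreal (of_rat p)" "ennreal (of_rat p) < ennreal (of_rat q)"
        using ennreal_rat_dense by blast
      have "0 < (of_rat p :: real)" using p(1) by (metis ennreal_eq_0_iff not_less not_less_zero)
      then have pq: "0 \<le> p" "p < q" using p(2) by (auto simp: ennreal_less_iff of_rat_less)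
      have "\<exists>\<^sub>F t in sequentially. U t x \<le> of_rat p"
      proof (rule ccontr)
        assume "\<not> (\<exists>\<^sub>F t in sequentially. U t x \<le> of_rat p)"
        then have "\<forall>\<^sub>F t in sequentially. ennreal (of_rat p) \<le> ?u t"
          by (auto simp: not_frequently elim!: eventually_mono intro: ennreal_leI)
        then show False using Liminf_bounded p(1) by (metis not_less)
      qed
      moreover have "\<exists>\<^sub>F t in sequentially. of_rat q \<le> U t x"
      proof (rule ccontr)
        assume "\<not> (\<exists>\<^sub>F t in sequentially. of_rat q \<le> U t x)"
        then have "\<forall>\<^sub>F t in sequentially. ?u t \<le> ennreal (of_rat q)"
          by (auto simp: not_frequently elim!: eventually_mono intro: ennreal_leI)
        then show False using Limsup_bounded q(2) by (metis not_less)
      qed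
      ultimately show False using elim(2) pq by auto
    qed
    then have eq: "limsup ?u = liminf ?u"
      using Liminf_le_Limsup[of sequentially ?u] by (simp add: antisym)
    obtain l where l: "0 \<le> l" "liminf ?u = ennreal l"
      using elim(1) by (cases "liminf ?u" rule: ennreal_cases) auto
    have "?u \<longlonglongrightarrow> ennreal l"
      using eq l by (intro Liminf_eq_Limsup) auto
    then have "(\<lambda>t. U t x) \<longlonglongrightarrow> l" using l nonneg by (simp add: tendsto_ennreal_iff)
    then show ?case by (rule convergentI)
  qed
qed

end


text \<open>Dividing \<open>Y t\<close> by \<open>\<Prod>s<t. 1 + \<beta> s\<close> absorbs the growth factor: the quotients form a nonnegative
  supermartingale which in mean also pays for the rescaled decrements \<open>\<zeta>\<close>. Where \<open>\<beta>\<close> is summable the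
  products converge and stay bounded, so both statements survive the return to \<open>Y\<close> and \<open>\<zeta>\<close>. The
  rescaling also makes every expectation finite, although \<open>\<beta> t\<close> is a possibly unbounded random
  variable and \<open>Y t\<close> may fail to be integrable.\<close>

theorem Robbins_Siegmund:
  fixes Y \<beta> \<zeta> :: "nat \<Rightarrow> 'a \<Rightarrow> real"
  assumes Y: "\<And>t. Y t \<in> borel_measurable (F t)" "\<And>t x. 0 \<le> Y t x" "(\<integral>\<^sup>+x. Y 0 x \<partial>M) < \<infinity>"
    and \<beta>: "\<And>t. \<beta> t \<in> borel_measurable (F t)" "\<And>t x. 0 \<le> \<beta> t x"
    and \<zeta>: "\<And>t. \<zeta> t \<in> borel_measurable (F t)" "\<And>t x. 0 \<le> \<zeta> t x"
    and step: "\<And>t. AE x in M. nn_cond_exp M (F t) (\<lambda>x. ennreal (Y (Suc t) x)) x + ennreal (\<zeta> t x)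
                 \<le> ennreal ((1 + \<beta> t x) * Y t x)"
  shows "AE x in M. summable (\<lambda>t. \<beta> t x) \<longrightarrow> convergent (\<lambda>t. Y t x) \<and> summable (\<lambda>t. \<zeta> t x)"
proof -
  define R where "R = (\<lambda>t x. \<Prod>s<t. 1 + \<beta> s x)"
  have R1: "1 \<le> R t x" for t x unfolding R_def using \<beta>(2) by (intro prod_ge_1) simp
  then have R0: "0 < R t x" for t x by (meson less_le_trans zero_less_one)
  have R_Suc: "R (Suc t) x = R t x * (1 + \<beta> t x)" for t x by (simp add: R_def)
  \<comment> \<open>The product up to and including time \<open>t\<close> is known at time \<open>t\<close>, so it can be moved out of the
     conditional expectation of \<open>Y (Suc t)\<close>.\<close>
  have R_meas: "R (Suc t) \<in> borel_measurable (F t)" for t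
    unfolding R_def
    by (intro borel_measurable_prod borel_measurable_add borel_measurable_const measurable_F_mono[OF \<beta>(1)]) auto
  have R_meas': "R t \<in> borel_measurable (F t)" for t
  proof (cases t)
    case 0 then show ?thesis by (simp add: R_def)
  next
    case (Suc n) then show ?thesis using measurable_F_Suc[OF R_meas] by simp
  qed
  define U where "U = (\<lambda>t x. Y t x / R t x)"
  define \<xi> where "\<xi> = (\<lambda>t x. \<zeta> t x / R (Suc t) x)"
  have U_meas: "U t \<in> borel_measurable (F t)" for t
    unfolding U_def by (intro borel_measurable_divide Y R_meas')
  have \<xi>_meas: "\<xi> t \<in> borel_measurable (F t)" for t
    unfolding \<xi>_def by (intro borel_measurable_divide \<zeta> R_meas)
  note [measurable] = measurable_F_M[OF U_meas] measurable_F_M[OF \<xi>_meas] measurable_F_M[OF Y(1)]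
  have U0: "0 \<le> U t x" for t x unfolding U_def using Y(2) less_imp_le[OF R0] by (intro divide_nonneg_nonneg) auto
  have \<xi>0: "0 \<le> \<xi> t x" for t x unfolding \<xi>_def using \<zeta>(2) less_imp_le[OF R0] by (intro divide_nonneg_nonneg) auto
  have U_start: "(\<integral>\<^sup>+x. U 0 x \<partial>M) < \<infinity>" using Y(3) by (simp add: U_def R_def)
  have U_step: "AE x in M. nn_cond_exp M (F t) (\<lambda>x. ennreal (U (Suc t) x)) x + ennreal (\<xi> t x) \<le> ennreal (U t x)" for t
  proof -
    interpret S: finite_measure_subalgebra M "F t" by (rule finite_measure_subalgebra_F)
    have pull_out: "AE x in M. ennreal (1 / R (Suc t) x) * nn_cond_exp M (F t) (\<lambda>x. ennreal (Y (Suc t) x)) x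
        = nn_cond_exp M (F t) (\<lambda>x. ennreal (1 / R (Suc t) x) * ennreal (Y (Suc t) x)) x"
    proof (rule S.nn_cond_exp_prod)
      note [measurable] = R_meas[of t]
      show "(\<lambda>x. ennreal (1 / R (Suc t) x)) \<in> borel_measurable (F t)" by measurable
    qed measurable
    have scaled: "(\<lambda>x. ennreal (1 / R (Suc t) x) * ennreal (Y (Suc t) x)) = (\<lambda>x. ennreal (U (Suc t) x))"
      using R0 Y(2) by (auto simp: U_def fun_eq_iff less_imp_le simp flip: ennreal_mult)
    show ?thesis using pull_out[unfolded scaled] step[of t]
    proof eventually_elim
      case (elim x)
      have "nn_cond_exp M (F t) (\<lambda>x. ennreal (U (Suc t) x)) x + ennreal (\<xi> t x)
          = ennreal (1 / R (Suc t) x) * (nn_cond_exp M (F t) (\<lambda>x. ennreal (Y (Suc t) x)) x + ennreal (\<zeta> t x))"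
        using elim(1)[symmetric] R0[of "Suc t" x] \<zeta>(2)[of t x]
        by (simp add: distrib_left \<xi>_def less_imp_le flip: ennreal_mult)
      also have "\<dots> \<le> ennreal (1 / R (Suc t) x) * ennreal ((1 + \<beta> t x) * Y t x)"
        by (intro mult_left_mono elim) simp
      also have "\<dots> = ennreal (1 / R (Suc t) x * ((1 + \<beta> t x) * Y t x))"
        using R0[of "Suc t" x] \<beta>(2)[of t x] Y(2)[of t x] by (simp add: less_imp_le flip: ennreal_mult)
      also have "1 / R (Suc t) x * ((1 + \<beta> t x) * Y t x) = U t x"
        using \<beta>(2)[of t x] R0[of t x] by (simp add: R_Suc U_def divide_simps) 
      finally show ?case .
    qed
  qed
  have conv: "AE x in M. convergent (\<lambda>t. U t x)"
  proof (rule supermartingale_convergence[OF U_meas U0 U_start])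
    show "AE x in M. nn_cond_exp M (F t) (\<lambda>x. ennreal (U (Suc t) x)) x \<le> ennreal (U t x)" for t
      using U_step[of t] by eventually_elim (erule order_trans[rotated], simp)
  qed
  \<comment> \<open>Telescoping the expectations of the supermartingale inequality.\<close>
  have budget: "(\<integral>\<^sup>+x. U n x \<partial>M) + (\<Sum>t<n. \<integral>\<^sup>+x. \<xi> t x \<partial>M) \<le> (\<integral>\<^sup>+x. U 0 x \<partial>M)" for n
  proof (induction n)
    case (Suc n)
    interpret S: finite_measure_subalgebra M "F n" by (rule finite_measure_subalgebra_F)
    have "(\<integral>\<^sup>+x. U (Suc n) x \<partial>M) + (\<integral>\<^sup>+x. \<xi> n x \<partial>M)
        = (\<integral>\<^sup>+x. nn_cond_exp M (F n) (\<lambda>x. ennreal (U (Suc n) x)) x \<partial>M) + (\<integral>\<^sup>+x. \<xi> n x \<partial>M)"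
      using S.nn_cond_exp_intg[of "\<lambda>_. 1" "\<lambda>x. ennreal (U (Suc n) x)"] by simp
    also have "\<dots> = (\<integral>\<^sup>+x. nn_cond_exp M (F n) (\<lambda>x. ennreal (U (Suc n) x)) x + \<xi> n x \<partial>M)"
      by (rule nn_integral_add[symmetric]) measurable
    also have "\<dots> \<le> (\<integral>\<^sup>+x. U n x \<partial>M)" by (rule nn_integral_mono_AE[OF U_step])
    finally have "(\<integral>\<^sup>+x. U (Suc n) x \<partial>M) + (\<integral>\<^sup>+x. \<xi> n x \<partial>M) + (\<Sum>t<n. \<integral>\<^sup>+x. \<xi> t x \<partial>M)
        \<le> (\<integral>\<^sup>+x. U n x \<partial>M) + (\<Sum>t<n. \<integral>\<^sup>+x. \<xi> t x \<partial>M)"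
      by (rule add_right_mono)
    from order_trans[OF this Suc] show ?case by (simp add: ac_simps)
  qed simp
  have "(\<Sum>t<n. \<integral>\<^sup>+x. \<xi> t x \<partial>M) \<le> (\<integral>\<^sup>+x. U 0 x \<partial>M)" for n
    by (rule order_trans[OF _ budget[of n]]) simp
  then have "(\<Sum>t. \<integral>\<^sup>+x. \<xi> t x \<partial>M) \<le> (\<integral>\<^sup>+x. U 0 x \<partial>M)"
    unfolding suminf_eq_SUP by (rule SUP_least)
  then have "(\<integral>\<^sup>+x. (\<Sum>t. ennreal (\<xi> t x)) \<partial>M) \<noteq> \<infinity>"
    using U_start by (subst nn_integral_suminf) (auto simp: less_top[symmetric] top_unique)
  then have "AE x in M. (\<Sum>t. ennreal (\<xi> t x)) \<noteq> \<infinity>"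
    by (intro nn_integral_PInf_AE) auto
  with conv show ?thesis
  proof eventually_elim
    case (elim x)
    show ?case
    proof
      assume sum: "summable (\<lambda>t. \<beta> t x)"
      have inc: "incseq (\<lambda>t. R t x)"
        using R0 \<beta>(2) by (intro incseq_SucI) (simp add: R_Suc less_imp_le)
      have bound: "R t x \<le> exp (\<Sum>t. \<beta> t x)" for t
      proof -
        have "R t x \<le> (\<Prod>s<t. exp (\<beta> s x))"
          unfolding R_def using \<beta>(2) by (intro prod_mono) (simp add: add_nonneg_nonneg)
        also have "\<dots> = exp (\<Sum>s<t. \<beta> s x)" by (simp add: exp_sum)
        also have "\<dots> \<le> exp (\<Sum>t. \<beta> t x)" using sum_le_suminf[OF sum] \<beta>(2) by simp
        finally show ?thesis .
      qed
      obtain p where p: "(\<lambda>t. R t x) \<longlonglongrightarrow> p"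
        using incseq_convergent[OF inc] bound by blast
      obtain l where l: "(\<lambda>t. U t x) \<longlonglongrightarrow> l" using elim(1) by (auto simp: convergent_def)
      have "(\<lambda>t. U t x * R t x) \<longlonglongrightarrow> l * p" by (intro tendsto_mult l p)
      moreover have "(\<lambda>t. U t x * R t x) = (\<lambda>t. Y t x)"
        using R0[of _ x] by (auto simp: U_def fun_eq_iff) (metis less_irrefl)
      ultimately have "convergent (\<lambda>t. Y t x)" by (auto simp: convergent_def)
      moreover have "summable (\<lambda>t. \<zeta> t x)"
      proof (rule summable_comparison_test')
        have "summable (\<lambda>t. \<xi> t x)"
          using \<xi>0 elim(2) by (intro summable_suminf_not_top) auto
        then show "summable (\<lambda>t. exp (\<Sum>t. \<beta> t x) * \<xi> t x)" by (rule summable_mult)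
        show "norm (\<zeta> t x) \<le> exp (\<Sum>t. \<beta> t x) * \<xi> t x" for t
          using mult_right_mono[OF bound[of "Suc t"] \<xi>0[of t x]] \<zeta>(2)[of t x] R0[of "Suc t" x]
          by (simp add: \<xi>_def)
      qed
      ultimately show "convergent (\<lambda>t. Y t x) \<and> summable (\<lambda>t. \<zeta> t x)" ..
    qed
  qed
qed

end

section \<open>Conditional expectations from conditional densities\<close>

text \<open>Integrating against the conditional density computes conditional expectations not only of
  functions of \<open>X\<close>: a function \<open>g\<close> of \<open>X\<close> and of the information in \<open>F\<close> may be treated with the second
  argument frozen. The joint law of \<open>X\<close> and the identity map into \<open>F\<close> and the measure with density
  \<open>k\<close> agree on rectangles by hypothesis, and rectangles determine a finite measure.\<close>

lemma nn_cond_exp_conditional_density: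
  fixes k :: "'x \<Rightarrow> 'a \<Rightarrow> real" and g :: "'x \<times> 'a \<Rightarrow> ennreal"
  assumes "prob_space M" and sub: "subalgebra M F" and \<mu>: "sigma_finite_measure \<mu>"
    and X [measurable]: "X \<in> M \<rightarrow>\<^sub>M \<mu>"
    and k: "(\<lambda>(z, x). k z x) \<in> borel_measurable (\<mu> \<Otimes>\<^sub>M F)"
    and k_nonneg: "\<And>z x. z \<in> space \<mu> \<Longrightarrow> x \<in> space M \<Longrightarrow> 0 \<le> k z x"
    and k_total: "\<And>x. x \<in> space M \<Longrightarrow> (\<integral>\<^sup>+z. ennreal (k z x) \<partial>\<mu>) = 1"
    and cond: "\<And>B. B \<in> sets \<mu> \<Longrightarrow> AE x in M.
      real_cond_exp M F (\<lambda>x. indicator B (X x)) x = (\<integral>z. k z x * indicator B z \<partial>\<mu>)"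
    and g [measurable]: "g \<in> borel_measurable (\<mu> \<Otimes>\<^sub>M F)"
  shows "AE x in M. nn_cond_exp M F (\<lambda>x. g (X x, x)) x = (\<integral>\<^sup>+z. ennreal (k z x) * g (z, x) \<partial>\<mu>)"
proof -
  interpret prob_space M by fact
  interpret S: finite_measure_subalgebra M F by unfold_locales (rule sub)
  interpret \<mu>: sigma_finite_measure \<mu> by fact
  define N where "N = restr_to_subalg M F"
  interpret N: prob_space N
    unfolding N_def by (rule prob_space_restr_to_subalg[OF sub]) unfold_locales
  interpret \<mu>N: pair_sigma_finite \<mu> N by unfold_locales
  have space_F: "space F = space M" using sub by (simp add: subalgebra_def)
  have space_N: "space N = space M" by (simp add: N_def space_restr_to_subalg)
  have sets_N [measurable_cong]: "sets N = sets F"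
    unfolding N_def by (rule sets_restr_to_subalg[OF sub])
  have from_F: "f \<in> measurable M L" if "f \<in> measurable F L" for f :: "'a \<Rightarrow> 'c" and L
    by (rule measurable_from_subalg[OF sub that])
  have id_F [measurable]: "(\<lambda>x. x) \<in> measurable M F" by (rule from_F) simp
  have [measurable]: "(\<lambda>p. k (fst p) (snd p)) \<in> borel_measurable (\<mu> \<Otimes>\<^sub>M F)"
    using k by (simp add: case_prod_unfold)
  have swap: "(\<lambda>p. q (snd p, fst p)) \<in> borel_measurable (F \<Otimes>\<^sub>M \<mu>)"
    if "q \<in> borel_measurable (\<mu> \<Otimes>\<^sub>M F)" for q :: "'x \<times> 'a \<Rightarrow> 'c::topological_space"
    using measurable_pair_swap[OF that] by (simp add: case_prod_unfold)
  note [measurable] = swap[OF k, simplified] swap[OF g]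
  note N_integral = nn_integral_subalgebra2[OF sub, folded N_def]
  define D1 where "D1 = distr M (\<mu> \<Otimes>\<^sub>M F) (\<lambda>x. (X x, x))"
  define D2 where "D2 = density (\<mu> \<Otimes>\<^sub>M N) (\<lambda>p. ennreal (k (fst p) (snd p)))"
  have sets_eq: "sets (\<mu> \<Otimes>\<^sub>M N) = sets (\<mu> \<Otimes>\<^sub>M F)"
    by (rule sets_pair_measure_cong) (simp_all add: sets_N)
  have D2_integral: "(\<integral>\<^sup>+p. q p \<partial>D2) = (\<integral>\<^sup>+x. (\<integral>\<^sup>+z. ennreal (k z x) * q (z, x) \<partial>\<mu>) \<partial>M)"
    if [measurable]: "q \<in> borel_measurable (\<mu> \<Otimes>\<^sub>M F)" for q
  proof -
    note [measurable] = swap[OF that]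
    have "(\<integral>\<^sup>+p. q p \<partial>D2) = (\<integral>\<^sup>+p. ennreal (k (fst p) (snd p)) * q p \<partial>(\<mu> \<Otimes>\<^sub>M N))"
      unfolding D2_def by (rule nn_integral_density) measurable
    also have "\<dots> = (\<integral>\<^sup>+x. (\<integral>\<^sup>+z. ennreal (k z x) * q (z, x) \<partial>\<mu>) \<partial>N)"
      by (subst \<mu>N.nn_integral_snd[symmetric]) simp_all
    also have "\<dots> = (\<integral>\<^sup>+x. (\<integral>\<^sup>+z. ennreal (k z x) * q (z, x) \<partial>\<mu>) \<partial>M)"
      by (rule N_integral) measurable
    finally show ?thesis .
  qed
  have rectangles: "emeasure D1 (B \<times> C) = emeasure D2 (B \<times> C)"
    if B [measurable]: "B \<in> sets \<mu>" and C [measurable]: "C \<in> sets F" for B C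
  proof -
    let ?c = "real_cond_exp M F (\<lambda>x. indicator B (X x))"
    have [measurable]: "C \<in> sets M" using C sub by (auto simp: subalgebra_def)
    have int_B: "integrable M (\<lambda>x. indicator B (X x) :: real)"
      by (rule integrable_const_bound[of _ 1]) auto
    have int_kB: "integrable \<mu> (\<lambda>z. k z x * indicator B z)" if x: "x \<in> space M" for x
    proof -
      have [measurable]: "(\<lambda>z. k z x) \<in> borel_measurable \<mu>"
        using measurable_compose[OF measurable_Pair2'[of x F \<mu>] k] x by (simp add: space_F)
      have "integrable \<mu> (\<lambda>z. k z x)"
        using k_total[OF x] k_nonneg[OF _ x] by (intro integrableI_nonneg) (auto intro!: AE_I2)
      then show ?thesis by (rule integrable_real_mult_indicator[OF B, simplified mult.commute])
    qed
    have inner: "(\<integral>\<^sup>+z. ennreal (k z x) * indicator (B \<times> C) (z, x) \<partial>\<mu>)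
        = indicator C x * ennreal (\<integral>z. k z x * indicator B z \<partial>\<mu>)" if x: "x \<in> space M" for x
    proof -
      have "(\<integral>\<^sup>+z. ennreal (k z x) * indicator (B \<times> C) (z, x) \<partial>\<mu>)
          = (\<integral>\<^sup>+z. indicator C x * ennreal (k z x * indicator B z) \<partial>\<mu>)"
        by (rule nn_integral_cong) (auto simp: indicator_def)
      also have "\<dots> = indicator C x * (\<integral>\<^sup>+z. ennreal (k z x * indicator B z) \<partial>\<mu>)"
        using int_kB[OF x] by (intro nn_integral_cmult) (auto dest: borel_measurable_integrable)
      also have "(\<integral>\<^sup>+z. ennreal (k z x * indicator B z) \<partial>\<mu>) = ennreal (\<integral>z. k z x * indicator B z \<partial>\<mu>)"
        using k_nonneg[OF _ x] by (intro nn_integral_eq_integral int_kB[OF x] AE_I2) auto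
      finally show ?thesis .
    qed
    \<comment> \<open>The hypothesis concerns the real-valued conditional expectation, so the computation passes
       through Bochner integrals of nonnegative functions.\<close>
    have c_nonneg: "AE x in M. 0 \<le> ?c x"
      by (rule S.real_cond_exp_pos) auto
    have "emeasure D2 (B \<times> C) = (\<integral>\<^sup>+p. indicator (B \<times> C) p \<partial>D2)"
      by (rule nn_integral_indicator[symmetric]) (simp add: D2_def sets_eq)
    also have "\<dots> = (\<integral>\<^sup>+x. (\<integral>\<^sup>+z. ennreal (k z x) * indicator (B \<times> C) (z, x) \<partial>\<mu>) \<partial>M)"
      by (rule D2_integral) measurable
    also have "\<dots> = (\<integral>\<^sup>+x. indicator C x * ennreal (\<integral>z. k z x * indicator B z \<partial>\<mu>) \<partial>M)"
      by (rule nn_integral_cong) (rule inner)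
    also have "\<dots> = (\<integral>\<^sup>+x. ennreal (indicator C x * ?c x) \<partial>M)"
      using cond[OF B] by (intro nn_integral_cong_AE) (auto simp: indicator_def elim!: eventually_mono)
    also have "\<dots> = ennreal (\<integral>x. indicator C x * ?c x \<partial>M)"
      using c_nonneg integrable_mult_indicator[OF \<open>C \<in> sets M\<close> S.real_cond_exp_int(1)[OF int_B]]
      by (intro nn_integral_eq_integral) (auto elim!: eventually_mono)
    also have "(\<integral>x. indicator C x * ?c x \<partial>M) = (\<integral>x. indicator C x * indicator B (X x) \<partial>M)"
      using S.real_cond_exp_intA[OF int_B C] by (simp add: set_lebesgue_integral_def)
    also have "\<dots> = (\<integral>x. indicator (C \<inter> (X -` B \<inter> space M)) x \<partial>M)"
      by (rule Bochner_Integration.integral_cong) (auto simp: indicator_def)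
    also have "ennreal \<dots> = emeasure M (C \<inter> (X -` B \<inter> space M))"
      by (simp add: emeasure_eq_measure)
    also have "\<dots> = emeasure D1 (B \<times> C)"
      using sets.sets_into_space[OF \<open>C \<in> sets M\<close>]
      unfolding D1_def by (subst emeasure_distr) (auto intro!: arg_cong[where f = "emeasure M"])
    finally show ?thesis by simp
  qed
  have D_eq: "D1 = D2"
  proof (rule measure_eqI_generator_eq[OF Int_stable_pair_measure_generator[of \<mu> F]])
    let ?E = "{a \<times> b |a b. a \<in> sets \<mu> \<and> b \<in> sets F}"
    show "?E \<subseteq> Pow (space \<mu> \<times> space F)"
      using sets.space_closed[of \<mu>] sets.space_closed[of F] by auto
    show "sets D1 = sigma_sets (space \<mu> \<times> space F) ?E"
      by (simp add: D1_def sets_pair_measure)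
    show "sets D2 = sigma_sets (space \<mu> \<times> space F) ?E"
      by (simp add: D2_def sets_pair_measure sets_N space_N space_F)
    show "emeasure D1 Z = emeasure D2 Z" if "Z \<in> ?E" for Z
      using that rectangles by auto
    show "range (\<lambda>_::nat. space \<mu> \<times> space F) \<subseteq> ?E" by auto
    show "emeasure D1 (space \<mu> \<times> space F) \<noteq> \<infinity>"
      unfolding D1_def by (subst emeasure_distr) auto
  qed auto
  have "AE x in M. (\<integral>\<^sup>+z. ennreal (k z x) * g (z, x) \<partial>\<mu>) = nn_cond_exp M F (\<lambda>x. g (X x, x)) x"
  proof (rule S.nn_cond_exp_charact)
    fix A assume [measurable]: "A \<in> sets F"
    have "(\<integral>\<^sup>+x\<in>A. g (X x, x) \<partial>M) = (\<integral>\<^sup>+p. g p * indicator A (snd p) \<partial>D1)"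
      unfolding D1_def by (subst nn_integral_distr) simp_all
    also have "\<dots> = (\<integral>\<^sup>+x. (\<integral>\<^sup>+z. ennreal (k z x) * (g (z, x) * indicator A x) \<partial>\<mu>) \<partial>M)"
      unfolding D_eq by (subst D2_integral) simp_all
    also have "\<dots> = (\<integral>\<^sup>+x\<in>A. (\<integral>\<^sup>+z. ennreal (k z x) * g (z, x) \<partial>\<mu>) \<partial>M)"
      by (rule nn_integral_cong) (simp add: indicator_def)
    finally show "(\<integral>\<^sup>+x\<in>A. g (X x, x) \<partial>M) = (\<integral>\<^sup>+x\<in>A. (\<integral>\<^sup>+z. ennreal (k z x) * g (z, x) \<partial>\<mu>) \<partial>M)" .
  qed measurable
  then show ?thesis by (auto elim!: eventually_mono)
qed

section \<open>The observation process and the estimator\<close>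

context observation_model
begin

lemma space_P: "space (P \<theta>) = space \<F>"
  by (rule sets_eq_imp_space_eq[OF sets_P])

lemma obs_generator_subset:
  "(\<Union>i\<in>{1..t}. {X i -` B \<inter> space \<F> |B. B \<in> sets \<mu>}) \<subseteq> sets \<F>"
  using obs by (auto intro: measurable_sets)

lemma space_obs_algebra: "space (obs_algebra \<F> \<mu> X t) = space \<F>"
  unfolding obs_algebra_def by (rule space_measure_of_conv)

lemma sets_obs_algebra:
  "sets (obs_algebra \<F> \<mu> X t) =
     sigma_sets (space \<F>) (\<Union>i\<in>{1..t}. {X i -` B \<inter> space \<F> |B. B \<in> sets \<mu>})"
  unfolding obs_algebra_def
  by (rule sets_measure_of) (use obs_generator_subset sets.space_closed in blast)

lemma discrete_filtration_obs: "discrete_filtration (P \<theta>) (obs_algebra \<F> \<mu> X)"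
proof (intro discrete_filtration.intro prob discrete_filtration_axioms.intro)
  show "subalgebra (P \<theta>) (obs_algebra \<F> \<mu> X t)" for t
    unfolding subalgebra_def space_obs_algebra space_P sets_obs_algebra sets_P
    using sets.sigma_sets_subset[OF obs_generator_subset] by simp
  show "subalgebra (obs_algebra \<F> \<mu> X (Suc t)) (obs_algebra \<F> \<mu> X t)" for t
    unfolding subalgebra_def space_obs_algebra sets_obs_algebra
    by (intro conjI refl sigma_sets_mono' UN_mono) auto
qed

lemma obs_measurable_obs_algebra:
  assumes "i \<in> {1..t}"
  shows "X i \<in> obs_algebra \<F> \<mu> X t \<rightarrow>\<^sub>M \<mu>"
proof (rule measurableI)
  show "X i \<omega> \<in> space \<mu>" if "\<omega> \<in> space (obs_algebra \<F> \<mu> X t)" for \<omega>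
    using that assms obs[of i] by (auto simp: space_obs_algebra dest: measurable_space)
  show "X i -` B \<inter> space (obs_algebra \<F> \<mu> X t) \<in> sets (obs_algebra \<F> \<mu> X t)" if "B \<in> sets \<mu>" for B
    unfolding sets_obs_algebra space_obs_algebra using that assms by (intro sigma_sets.Basic) blast
qed

lemma hist_measurable: "hist X t \<in> obs_algebra \<F> \<mu> X t \<rightarrow>\<^sub>M Pi\<^sub>M {1..t} (\<lambda>_. \<mu>)"
  unfolding hist_def[abs_def] by (intro measurable_restrict obs_measurable_obs_algebra)

lemma hist_Suc: "hist X (Suc t) \<omega> = (hist X t \<omega>)(Suc t := X (Suc t) \<omega>)"
  by (auto simp: hist_def fun_eq_iff)

lemma hist_prolong_measurable:
  "(\<lambda>(z, \<omega>). (hist X t \<omega>)(Suc t := z)) \<in> \<mu> \<Otimes>\<^sub>M obs_algebra \<F> \<mu> X t \<rightarrow>\<^sub>M Pi\<^sub>M {1..Suc t} (\<lambda>_. \<mu>)"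
  unfolding case_prod_unfold
  by (rule measurable_fun_upd[where J = "{1..t}"])
     (simp_all add: measurable_compose[OF measurable_snd hist_measurable[unfolded One_nat_def]] atLeastAtMostSuc_conv)

lemma density_hist_measurable:
  "(\<lambda>(z, \<omega>). f (Suc t) \<theta> z (hist X t \<omega>)) \<in> borel_measurable (\<mu> \<Otimes>\<^sub>M obs_algebra \<F> \<mu> X t)"
proof -
  have "(\<lambda>p. (fst p, hist X t (snd p))) \<in> \<mu> \<Otimes>\<^sub>M obs_algebra \<F> \<mu> X t \<rightarrow>\<^sub>M \<mu> \<Otimes>\<^sub>M Pi\<^sub>M {1..t} (\<lambda>_. \<mu>)"
    by (intro measurable_Pair measurable_fst measurable_compose[OF measurable_snd hist_measurable])
  from measurable_compose[OF this density_measurable[of "Suc t" \<theta>, unfolded diff_Suc_1]]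
  show ?thesis by (simp add: case_prod_unfold)
qed

lemma hist_space: "\<omega> \<in> space \<F> \<Longrightarrow> hist X t \<omega> \<in> space (Pi\<^sub>M {1..t} (\<lambda>_. \<mu>))"
  using measurable_space[OF hist_measurable] by (simp add: space_obs_algebra)

text \<open>Conditional means computed from the densities are genuine conditional expectations given the
  observations up to time \<open>t\<close>.\<close>

lemma nn_cond_exp_next_observation:
  assumes g: "g \<in> borel_measurable (\<mu> \<Otimes>\<^sub>M obs_algebra \<F> \<mu> X t)"
  shows "AE \<omega> in P \<theta>. nn_cond_exp (P \<theta>) (obs_algebra \<F> \<mu> X t) (\<lambda>\<omega>. g (X (Suc t) \<omega>, \<omega>)) \<omega>
     = (\<integral>\<^sup>+z. ennreal (f (Suc t) \<theta> z (hist X t \<omega>)) * g (z, \<omega>) \<partial>\<mu>)"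
proof (rule nn_cond_exp_conditional_density[OF prob _ sigma_finite _ density_hist_measurable _ _ _ g])
  interpret discrete_filtration "P \<theta>" "obs_algebra \<F> \<mu> X" by (rule discrete_filtration_obs)
  show "subalgebra (P \<theta>) (obs_algebra \<F> \<mu> X t)" by (rule subalg)
  show "X (Suc t) \<in> P \<theta> \<rightarrow>\<^sub>M \<mu>"
    using obs[of "Suc t"] by (simp cong: measurable_cong_sets add: sets_P)
qed (use density_nonneg[of "Suc t"] density_total[of "Suc t"] density_cond[of "Suc t"] hist_space
     in \<open>auto simp: space_P\<close>)

context
  fixes \<psi> :: "nat \<Rightarrow> real^'m \<Rightarrow> (nat \<Rightarrow> 'x) \<Rightarrow> real^'m"
    and \<Gamma> :: "nat \<Rightarrow> real^'m \<Rightarrow> (nat \<Rightarrow> 'x) \<Rightarrow> real^'m^'m"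
  assumes psi: "\<And>t. t \<ge> 1 \<Longrightarrow>
          (\<lambda>(v, x). \<psi> t v x) \<in> borel_measurable (borel \<Otimes>\<^sub>M Pi\<^sub>M {1..t} (\<lambda>_. \<mu>))"
    and Gamma: "\<And>t. t \<ge> 1 \<Longrightarrow>
          (\<lambda>(v, h). \<Gamma> t v h) \<in> borel_measurable (borel \<Otimes>\<^sub>M Pi\<^sub>M {1..t - 1} (\<lambda>_. \<mu>))"
begin

lemma psi_compose:
  assumes "v \<in> borel_measurable N" "h \<in> N \<rightarrow>\<^sub>M Pi\<^sub>M {1..Suc t} (\<lambda>_. \<mu>)"
  shows "(\<lambda>x. \<psi> (Suc t) (v x) (h x)) \<in> borel_measurable N"
  using measurable_compose[OF measurable_Pair[OF assms] psi[of "Suc t"]] by simp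

lemma Gamma_compose:
  assumes "v \<in> borel_measurable N" "h \<in> N \<rightarrow>\<^sub>M Pi\<^sub>M {1..t} (\<lambda>_. \<mu>)"
  shows "(\<lambda>x. matrix_inv (\<Gamma> (Suc t) (v x) (h x))) \<in> borel_measurable N"
proof -
  have "(\<lambda>x. \<Gamma> (Suc t) (v x) (h x)) \<in> borel_measurable N"
    using measurable_compose[OF measurable_Pair[OF assms] Gamma[of "Suc t", unfolded diff_Suc_1]] by simp
  from measurable_compose[OF this borel_measurable_matrix_inv] show ?thesis .
qed

lemma estimator_measurable:
  "estimator X \<Gamma> \<psi> \<theta>0 t \<in> borel_measurable (obs_algebra \<F> \<mu> X t)"
proof (induction t)
  case 0 then show ?case by (simp add: fun_eq_iff measurable_const[of \<theta>0] estimator.simps(1)[abs_def])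
next
  case (Suc t)
  \<comment> \<open>That the observation algebras increase is the same statement for every member of \<open>P\<close>.\<close>
  interpret discrete_filtration "P undefined" "obs_algebra \<F> \<mu> X" by (rule discrete_filtration_obs)
  show ?case
    unfolding estimator.simps(2)[abs_def]
    by (intro borel_measurable_add borel_measurable_matrix_vector_mult psi_compose Gamma_compose
        measurable_F_Suc[OF Suc] measurable_F_Suc[OF hist_measurable] hist_measurable)
qed

lemma increment_measurable:
  "(\<lambda>(z, \<omega>). matrix_inv (\<Gamma> (Suc t) (estimator X \<Gamma> \<psi> \<theta>0 t \<omega>) (hist X t \<omega>)) *v
      \<psi> (Suc t) (estimator X \<Gamma> \<psi> \<theta>0 t \<omega>) ((hist X t \<omega>)(Suc t := z)))
   \<in> borel_measurable (\<mu> \<Otimes>\<^sub>M obs_algebra \<F> \<mu> X t)"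
  unfolding case_prod_unfold
  by (intro borel_measurable_matrix_vector_mult psi_compose Gamma_compose
      measurable_compose[OF measurable_snd estimator_measurable]
      measurable_compose[OF measurable_snd hist_measurable]
      hist_prolong_measurable[unfolded case_prod_unfold])

lemma drift_measurable:
  assumes grad: "gradient V \<in> borel_measurable borel"
  shows "(\<lambda>\<omega>. drift \<mu> f \<Gamma> \<psi> V \<theta> (Suc t) (estimator X \<Gamma> \<psi> \<theta>0 t \<omega> - \<theta>) (hist X t \<omega>))
     \<in> borel_measurable (obs_algebra \<F> \<mu> X t)"
proof -
  interpret sigma_finite_measure \<mu> by (rule sigma_finite)
  let ?F = "obs_algebra \<F> \<mu> X t" and ?e = "estimator X \<Gamma> \<psi> \<theta>0 t"
  have swap: "(\<lambda>(\<omega>, z). q z \<omega>) \<in> borel_measurable (?F \<Otimes>\<^sub>M \<mu>)"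
    if "(\<lambda>(z, \<omega>). q z \<omega>) \<in> borel_measurable (\<mu> \<Otimes>\<^sub>M ?F)" for q :: "'x \<Rightarrow> 'w \<Rightarrow> 'c::topological_space"
    using measurable_pair_swap[OF that] by simp
  have psi': "(\<lambda>(z, \<omega>). \<psi> (Suc t) (?e \<omega>) ((hist X t \<omega>)(Suc t := z))) \<in> borel_measurable (\<mu> \<Otimes>\<^sub>M ?F)"
    unfolding case_prod_unfold
    by (intro psi_compose measurable_compose[OF measurable_snd estimator_measurable]
        hist_prolong_measurable[unfolded case_prod_unfold])
  have [measurable]: "(\<lambda>\<omega>. \<integral>z. f (Suc t) \<theta> z (hist X t \<omega>) *\<^sub>R \<psi> (Suc t) (?e \<omega>) ((hist X t \<omega>)(Suc t := z)) \<partial>\<mu>)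
      \<in> borel_measurable ?F"
    using swap[OF density_hist_measurable] swap[OF psi']
    by (intro borel_measurable_lebesgue_integral) (simp add: case_prod_unfold)
  have [measurable]: "(\<lambda>\<omega>. \<integral>z. f (Suc t) \<theta> z (hist X t \<omega>) * (norm (matrix_inv (\<Gamma> (Suc t) (?e \<omega>) (hist X t \<omega>)) *v
       \<psi> (Suc t) (?e \<omega>) ((hist X t \<omega>)(Suc t := z))))\<^sup>2 \<partial>\<mu>) \<in> borel_measurable ?F"
    using swap[OF density_hist_measurable] swap[OF increment_measurable]
    by (intro borel_measurable_lebesgue_integral) (simp add: case_prod_unfold)
  note [measurable] = estimator_measurable grad Gamma_compose[OF estimator_measurable hist_measurable]
  show ?thesis unfolding drift_def cond_mean_def by simp
qed

end

end


section \<open>Drift and convergence\<close>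

text \<open>Taking conditional means in Taylor's bound turns the linear and the quadratic term of the increment
  into the drift. The summand \<open>1\<close> is carried along because \<open>1 + V\<close> is the process to which the
  Robbins-Siegmund theorem is applied. Nonnegativity of the bound is recorded separately since
  \<open>ennreal\<close> would turn a negative bound into \<open>0\<close>, losing the drift.\<close>

lemma integral_taylor_drift:
  fixes V :: "real^'m::finite \<Rightarrow> real" and \<psi> :: "nat \<Rightarrow> real^'m \<Rightarrow> (nat \<Rightarrow> 'x) \<Rightarrow> real^'m"
  assumes C2: "C2_bounded V" and V_nonneg: "\<And>u. 0 \<le> V u"
    and meas: "(\<lambda>z. f t \<theta> z h) \<in> borel_measurable \<mu>"
    and nonneg: "\<And>z. z \<in> space \<mu> \<Longrightarrow> 0 \<le> f t \<theta> z h"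
    and total: "(\<integral>\<^sup>+z. ennreal (f t \<theta> z h) \<partial>\<mu>) = 1"
    and mean: "cond_mean_exists \<mu> (f t \<theta>) t (\<psi> t (\<theta> + u)) h"
    and square: "cond_mean_exists \<mu> (f t \<theta>) t
            (\<lambda>x. (norm (matrix_inv (\<Gamma> t (\<theta> + u) h) *v \<psi> t (\<theta> + u) x))\<^sup>2) h"
  shows "(\<integral>\<^sup>+z. ennreal (f t \<theta> z h) *
             ennreal (1 + V (u + matrix_inv (\<Gamma> t (\<theta> + u) h) *v \<psi> t (\<theta> + u) (h(t := z)))) \<partial>\<mu>)
           \<le> ennreal (1 + V u + drift \<mu> f \<Gamma> \<psi> V \<theta> t u h)" (is "?L \<le> _")
    and "0 \<le> 1 + V u + drift \<mu> f \<Gamma> \<psi> V \<theta> t u h"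
proof -
  define k where "k = (\<lambda>z. f t \<theta> z h)"
  define G where "G = matrix_inv (\<Gamma> t (\<theta> + u) h)"
  define p where "p = (\<lambda>z. \<psi> t (\<theta> + u) (h(t := z)))"
  define c where "c = 1 / 2 * (SUP v. op_norm (hessian V v))"
  define T where "T = (\<lambda>y. gradient V u \<bullet> (G *v y))"
  \<comment> \<open>Taylor's bound at \<open>z\<close>, weighted by the density and grouped so that each summand is integrable
     by one of the hypotheses.\<close>
  define r where "r = (\<lambda>z. k z * (1 + V u) + T (k z *\<^sub>R p z) + c * (k z * (norm (G *v p z))\<^sup>2))"
  have T: "bounded_linear T"
    unfolding T_def by (intro bounded_linear_compose[OF bounded_linear_inner_right matrix_vector_mul_bounded_linear])
  have k_int: "integrable \<mu> k" and k_one: "(\<integral>z. k z \<partial>\<mu>) = 1"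
  proof -
    show "integrable \<mu> k"
      using meas total nonneg by (intro integrableI_nonneg) (auto simp: k_def)
    then have "(\<integral>\<^sup>+z. ennreal (k z) \<partial>\<mu>) = ennreal (\<integral>z. k z \<partial>\<mu>)"
      using nonneg by (intro nn_integral_eq_integral) (auto simp: k_def)
    then show "(\<integral>z. k z \<partial>\<mu>) = 1" using total by (simp add: k_def)
  qed
  have kp_int: "integrable \<mu> (\<lambda>z. k z *\<^sub>R p z)"
    using mean by (simp add: cond_mean_exists_def k_def p_def)
  have sq_int: "integrable \<mu> (\<lambda>z. k z * (norm (G *v p z))\<^sup>2)"
    using square by (simp add: cond_mean_exists_def k_def p_def G_def)
  have r_int: "integrable \<mu> r"
    unfolding r_def by (intro Bochner_Integration.integrable_add integrable_mult_left
        integrable_mult_right k_int sq_int integrable_bounded_linear[OF T kp_int])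
  have "(\<integral>z. r z \<partial>\<mu>) = 1 + V u + T (\<integral>z. k z *\<^sub>R p z \<partial>\<mu>) + c * (\<integral>z. k z * (norm (G *v p z))\<^sup>2 \<partial>\<mu>)"
    unfolding r_def using k_one
    by (simp add: k_int sq_int integrable_bounded_linear[OF T kp_int] integral_bounded_linear[OF T kp_int])
  then have r_eq: "(\<integral>z. r z \<partial>\<mu>) = 1 + V u + drift \<mu> f \<Gamma> \<psi> V \<theta> t u h"
    unfolding drift_def cond_mean_def T_def c_def k_def p_def G_def by simp
  have r_ge: "k z * (1 + V (u + G *v p z)) \<le> r z" if "z \<in> space \<mu>" for z
  proof -
    have "T (k z *\<^sub>R p z) = k z * (gradient V u \<bullet> (G *v p z))"
      by (subst linear_scale[OF bounded_linear.linear[OF T]]) (simp add: T_def)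
    then have "r z = k z * (1 + (V u + gradient V u \<bullet> (G *v p z) + c * (norm (G *v p z))\<^sup>2))"
      by (simp add: r_def algebra_simps)
    then show ?thesis
      using taylor_upper_bound[OF C2, of u "G *v p z"] nonneg[OF that]
      by (auto simp: c_def k_def intro!: mult_left_mono)
  qed
  have r_nonneg: "0 \<le> r z" if "z \<in> space \<mu>" for z
    using r_ge[OF that] nonneg[OF that] V_nonneg by (auto simp: k_def intro: order_trans[rotated])
  have "?L \<le> (\<integral>\<^sup>+z. ennreal (r z) \<partial>\<mu>)"
  proof (rule nn_integral_mono)
    fix z assume z: "z \<in> space \<mu>"
    have "ennreal (k z) * ennreal (1 + V (u + G *v p z)) = ennreal (k z * (1 + V (u + G *v p z)))"
      using nonneg[OF z] V_nonneg by (intro ennreal_mult[symmetric]) (auto simp: k_def add_nonneg_nonneg)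
    also have "\<dots> \<le> ennreal (r z)" by (rule ennreal_leI[OF r_ge[OF z]])
    finally show "ennreal (f t \<theta> z h) *
        ennreal (1 + V (u + matrix_inv (\<Gamma> t (\<theta> + u) h) *v \<psi> t (\<theta> + u) (h(t := z)))) \<le> ennreal (r z)"
      by (simp add: k_def p_def G_def)
  qed
  also have "\<dots> = ennreal (\<integral>z. r z \<partial>\<mu>)"
    using r_nonneg by (intro nn_integral_eq_integral r_int AE_I2)
  finally show "?L \<le> ennreal (1 + V u + drift \<mu> f \<Gamma> \<psi> V \<theta> t u h)" by (simp add: r_eq)
  have "0 \<le> (\<integral>z. r z \<partial>\<mu>)" by (rule Bochner_Integration.integral_nonneg) (rule r_nonneg)
  then show "0 \<le> 1 + V u + drift \<mu> f \<Gamma> \<psi> V \<theta> t u h" by (simp add: r_eq)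
qed

text \<open>If the limit were positive, \<open>v\<close> would eventually stay in one of the windows \<open>[\<epsilon>, 1 / \<epsilon>]\<close> with
  \<open>\<epsilon> = 1 / (n + 2)\<close>, and there the summable \<open>\<zeta>\<close> would dominate a divergent series. The finitely many
  terms before that time must be finite. For an infimum of real numbers taken in \<open>ennreal\<close> this means
  that the index set is nonempty, which a visit of \<open>v\<close> to the window guarantees. The windows form a
  countable family in order that almost sure divergence for each of them gives it for all of them outside
  a single null set.\<close>

lemma limit_zero_if_sum_diverges:
  fixes v \<zeta> :: "nat \<Rightarrow> real" and I :: "real \<Rightarrow> nat \<Rightarrow> ennreal"
  assumes v: "convergent v" "\<And>t. 0 \<le> v t"
    and \<zeta>: "summable \<zeta>" "\<And>t. 0 \<le> \<zeta> t"
    and diverges: "\<And>n. (\<Sum>t. I (1 / (real n + 2)) t) = \<infinity>"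
    and le: "\<And>\<epsilon> t. \<epsilon> \<le> v t \<Longrightarrow> v t \<le> 1 / \<epsilon> \<Longrightarrow> I \<epsilon> t \<le> ennreal (\<zeta> t)"
    and finite: "\<And>\<epsilon> s t. \<epsilon> \<le> v s \<Longrightarrow> v s \<le> 1 / \<epsilon> \<Longrightarrow> I \<epsilon> t < \<infinity>"
  shows "v \<longlonglongrightarrow> 0"
proof -
  obtain l where l: "v \<longlonglongrightarrow> l" using v(1) by (auto simp: convergent_def)
  have "0 \<le> l" using v(2) by (intro LIMSEQ_le_const[OF l]) auto
  moreover have "\<not> 0 < l"
  proof
    assume "0 < l"
    \<comment> \<open>An \<open>n\<close> above both \<open>l\<close> and \<open>1 / l\<close> puts \<open>l\<close> in the interior of the window.\<close>
    obtain n :: nat where n: "max l (1 / l) < real n" using reals_Archimedean2 by blast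
    define \<epsilon> where "\<epsilon> = 1 / (real n + 2)"
    have "1 / l < real n + 2" using n by simp
    then have "\<epsilon> < l" using \<open>0 < l\<close> by (simp add: \<epsilon>_def field_simps)
    moreover have "l < 1 / \<epsilon>" using n by (simp add: \<epsilon>_def)
    ultimately have "\<forall>\<^sub>F t in sequentially. \<epsilon> < v t \<and> v t < 1 / \<epsilon>"
      using order_tendstoD[OF l] by (intro eventually_conj) auto
    then obtain T where T: "\<And>t. t \<ge> T \<Longrightarrow> \<epsilon> \<le> v t \<and> v t \<le> 1 / \<epsilon>"
      unfolding eventually_sequentially by (meson less_imp_le)
    \<comment> \<open>A summable majorant of the window terms; before time \<open>T\<close> it takes over their own values.\<close>
    define c where "c = (\<lambda>t. if t < T then enn2real (I \<epsilon> t) else \<zeta> t)"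
    have "\<forall>\<^sub>F t in sequentially. c t = \<zeta> t"
      using eventually_ge_at_top[of T] by eventually_elim (simp add: c_def)
    then have c: "summable c" using \<zeta>(1) summable_cong by blast
    have c_nonneg: "0 \<le> c t" for t using \<zeta>(2) by (simp add: c_def)
    have "I \<epsilon> t \<le> ennreal (c t)" for t
      using le[of \<epsilon> t] T[of t] finite[of \<epsilon> T t] T[of T]
      by (auto simp: c_def not_less less_top)
    then have "(\<Sum>t. I \<epsilon> t) \<le> (\<Sum>t. ennreal (c t))" by (intro suminf_le) auto
    also have "\<dots> = ennreal (\<Sum>t. c t)" by (rule suminf_ennreal2[OF c_nonneg c])
    finally show False using diverges[of n] by (simp add: \<epsilon>_def top_unique)
  qed
  ultimately show ?thesis using l by simp
qed

text \<open>A function that is bounded away from \<open>0\<close> outside each ball around the origin controls the distance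
  to the origin.\<close>

lemma tendsto_zero_if_potential_tendsto_zero:
  fixes V :: "'b::real_normed_vector \<Rightarrow> real" and d :: "nat \<Rightarrow> 'b"
  assumes V_nonneg: "\<And>u. 0 \<le> V u"
    and sep: "\<And>\<epsilon>. 0 < \<epsilon> \<Longrightarrow> \<epsilon> < 1 \<Longrightarrow> 0 < (INF u\<in>{u. \<epsilon> \<le> norm u}. V u)"
    and lim: "(\<lambda>t. V (d t)) \<longlonglongrightarrow> 0"
  shows "d \<longlonglongrightarrow> 0"
proof (rule tendsto_norm_zero_cancel, rule order_tendstoI)
  fix e :: real assume "0 < e"
  \<comment> \<open>The separation of \<open>V\<close> from \<open>0\<close> is given for radii below \<open>1\<close>.\<close>
  define \<epsilon> where "\<epsilon> = min e (1 / 2)"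
  have \<epsilon>: "0 < \<epsilon>" "\<epsilon> < 1" "\<epsilon> \<le> e" using \<open>0 < e\<close> by (auto simp: \<epsilon>_def)
  have bdd: "bdd_below (V ` S)" for S using V_nonneg by (auto intro!: bdd_belowI[of _ 0])
  from order_tendstoD(2)[OF lim sep[OF \<epsilon>(1,2)]]
  show "\<forall>\<^sub>F t in sequentially. norm (d t) < e"
  proof eventually_elim
    case (elim t)
    have "\<not> \<epsilon> \<le> norm (d t)"
      using elim cINF_lower[OF bdd, of "d t" "{u. \<epsilon> \<le> norm u}"] by auto
    then show ?case using \<epsilon> by simp
  qed
next
  fix e :: real assume "e < 0"
  then show "\<forall>\<^sub>F t in sequentially. e < norm (d t)"
    by (intro always_eventually allI) (rule less_le_trans[OF _ norm_ge_zero])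
qed

theorem theorem3p2:
  fixes \<F> :: "'w measure" and \<mu> :: "'x measure"
    and P :: "real^'m \<Rightarrow> 'w measure"
    and X :: "nat \<Rightarrow> 'w \<Rightarrow> 'x"
    and f :: "nat \<Rightarrow> real^'m \<Rightarrow> 'x \<Rightarrow> (nat \<Rightarrow> 'x) \<Rightarrow> real"
    and \<psi> :: "nat \<Rightarrow> real^'m \<Rightarrow> (nat \<Rightarrow> 'x) \<Rightarrow> real^'m"
    and \<Gamma> :: "nat \<Rightarrow> real^'m \<Rightarrow> (nat \<Rightarrow> 'x) \<Rightarrow> real^'m^'m"
    and \<theta> \<theta>0 :: "real^'m"
    and V :: "real^'m \<Rightarrow> real"
    and A :: "'w set"
  defines "\<Delta> \<equiv> \<lambda>t \<omega>. estimator X \<Gamma> \<psi> \<theta>0 t \<omega> - \<theta>"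
    and "N \<equiv> \<lambda>t u \<omega>. drift \<mu> f \<Gamma> \<psi> V \<theta> t u (hist X (t - 1) \<omega>)"
  assumes model: "observation_model \<F> \<mu> P X f"
    and psi: "\<And>t. t \<ge> 1 \<Longrightarrow>
          (\<lambda>(v, x). \<psi> t v x) \<in> borel_measurable (borel \<Otimes>\<^sub>M Pi\<^sub>M {1..t} (\<lambda>_. \<mu>))"
    and Gamma: "\<And>t. t \<ge> 1 \<Longrightarrow>
          (\<lambda>(v, h). \<Gamma> t v h) \<in> borel_measurable (borel \<Otimes>\<^sub>M Pi\<^sub>M {1..t - 1} (\<lambda>_. \<mu>))"
    and Gamma_det: "\<And>t. t \<ge> 1 \<Longrightarrow> AE \<omega> in P \<theta>. \<forall>v. det (\<Gamma> t v (hist X (t - 1) \<omega>)) \<noteq> 0"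
    and mean_exists: "\<And>t. t \<ge> 1 \<Longrightarrow> AE \<omega> in P \<theta>. \<forall>u.
          cond_mean_exists \<mu> (f t \<theta>) t (\<psi> t (\<theta> + u)) (hist X (t - 1) \<omega>)"
    and square_mean_exists: "\<And>t. t \<ge> 1 \<Longrightarrow> AE \<omega> in P \<theta>. \<forall>u.
          cond_mean_exists \<mu> (f t \<theta>) t
            (\<lambda>x. (norm (matrix_inv (\<Gamma> t (\<theta> + u) (hist X (t - 1) \<omega>)) *v \<psi> t (\<theta> + u) x))\<^sup>2)
            (hist X (t - 1) \<omega>)"
    and V_nonneg: "\<And>u. 0 \<le> V u"
    and V_C2: "C2_bounded V"
    and G1: "V 0 = 0" "\<And>\<epsilon>. 0 < \<epsilon> \<Longrightarrow> \<epsilon> < 1 \<Longrightarrow> 0 < (INF u\<in>{u. \<epsilon> \<le> norm u}. V u)"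
    and G2: "A \<in> sets \<F>" "0 < measure (P \<theta>) A"
          "\<And>\<epsilon>. 0 < \<epsilon> \<Longrightarrow> \<epsilon> < 1 \<Longrightarrow> AE \<omega> in P \<theta>. \<omega> \<in> A \<longrightarrow>
             (\<Sum>t. INF u\<in>{u. \<epsilon> \<le> V u \<and> V u \<le> 1 / \<epsilon>}. ennreal (max 0 (- N (Suc t) u \<omega>))) = \<infinity>"
    and G3: "AE \<omega> in P \<theta>.
             summable (\<lambda>t. inverse (1 + V (\<Delta> t \<omega>)) * max 0 (N (Suc t) (\<Delta> t \<omega>) \<omega>))"
  shows "AE \<omega> in P \<theta>. \<omega> \<in> A \<longrightarrow> (\<lambda>t. estimator X \<Gamma> \<psi> \<theta>0 t \<omega>) \<longlonglongrightarrow> \<theta>"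
proof -
  interpret observation_model \<F> \<mu> P X f by (rule model)
  interpret discrete_filtration "P \<theta>" "obs_algebra \<F> \<mu> X" by (rule discrete_filtration_obs)
  let ?F = "obs_algebra \<F> \<mu> X" and ?e = "estimator X \<Gamma> \<psi> \<theta>0"
  \<comment> \<open>\<open>D t\<close> is the drift at the current error, split into its positive part, which
     is a multiple \<open>\<beta> t\<close> of \<open>Y t\<close>, and its negative part \<open>\<zeta> t\<close>.\<close>
  define Y where "Y = (\<lambda>t \<omega>. 1 + V (\<Delta> t \<omega>))"
  define D where "D = (\<lambda>t \<omega>. N (Suc t) (\<Delta> t \<omega>) \<omega>)"
  define \<beta> where "\<beta> = (\<lambda>t \<omega>. inverse (Y t \<omega>) * max 0 (D t \<omega>))"
  define \<zeta> where "\<zeta> = (\<lambda>t \<omega>. max 0 (- D t \<omega>))"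
  have Y_pos: "0 < Y t \<omega>" for t \<omega> using V_nonneg[of "\<Delta> t \<omega>"] by (simp add: Y_def)
  have V_meas: "V \<in> borel_measurable borel"
    by (rule borel_measurable_continuous_onI[OF continuous_on_C2[OF V_C2]])
  have grad_meas: "gradient V \<in> borel_measurable borel"
    by (rule borel_measurable_continuous_onI[OF continuous_on_gradient[OF V_C2]])
  note e_meas = estimator_measurable[OF psi Gamma]
  have Y_meas: "Y t \<in> borel_measurable (?F t)" for t
    unfolding Y_def \<Delta>_def
    by (intro borel_measurable_add borel_measurable_const measurable_compose[OF _ V_meas]
        borel_measurable_diff e_meas)
  have D_meas: "D t \<in> borel_measurable (?F t)" for t
    unfolding D_def N_def \<Delta>_def diff_Suc_1 by (rule drift_measurable[OF psi Gamma grad_meas])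
  have \<beta>_meas: "\<beta> t \<in> borel_measurable (?F t)" and \<zeta>_meas: "\<zeta> t \<in> borel_measurable (?F t)" for t
    unfolding \<beta>_def \<zeta>_def using Y_meas[of t] D_meas[of t] by measurable
  have start: "(\<integral>\<^sup>+\<omega>. Y 0 \<omega> \<partial>P \<theta>) < \<infinity>"
    by (simp add: Y_def \<Delta>_def emeasure_space_1)
  have step: "AE \<omega> in P \<theta>. nn_cond_exp (P \<theta>) (?F t) (\<lambda>\<omega>. ennreal (Y (Suc t) \<omega>)) \<omega> + ennreal (\<zeta> t \<omega>)
      \<le> ennreal ((1 + \<beta> t \<omega>) * Y t \<omega>)" for t
  proof -
    \<comment> \<open>\<open>1 + V\<close> after the next step, with the past frozen at \<open>\<omega>\<close> and the new observation \<open>z\<close> free.\<close>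
    define g where "g = (\<lambda>(z, \<omega>). ennreal (1 + V (\<Delta> t \<omega> +
       matrix_inv (\<Gamma> (Suc t) (?e t \<omega>) (hist X t \<omega>)) *v \<psi> (Suc t) (?e t \<omega>) ((hist X t \<omega>)(Suc t := z)))))"
    have g_meas: "g \<in> borel_measurable (\<mu> \<Otimes>\<^sub>M ?F t)"
      unfolding g_def \<Delta>_def case_prod_unfold
      by (intro measurable_compose[OF _ measurable_ennreal] borel_measurable_add borel_measurable_const
          measurable_compose[OF _ V_meas] borel_measurable_diff
          measurable_compose[OF measurable_snd e_meas]
          increment_measurable[OF psi Gamma, unfolded case_prod_unfold])
    have g_next: "g (X (Suc t) \<omega>, \<omega>) = ennreal (Y (Suc t) \<omega>)" for \<omega>
      by (simp add: g_def Y_def \<Delta>_def hist_Suc algebra_simps)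
    have one_le: "1 \<le> Suc t" by simp
    show ?thesis
      using nn_cond_exp_next_observation[OF g_meas, of \<theta>] mean_exists[of "Suc t", OF one_le]
        square_mean_exists[of "Suc t", OF one_le]
        AE_space
    proof eventually_elim
      case (elim \<omega>)
      let ?h = "hist X t \<omega>" and ?u = "\<Delta> t \<omega>"
      have h: "?h \<in> space (Pi\<^sub>M {1..t} (\<lambda>_. \<mu>))" using elim(4) hist_space by (simp add: space_P)
      have e: "?e t \<omega> = \<theta> + ?u" by (simp add: \<Delta>_def)
      have D: "D t \<omega> = drift \<mu> f \<Gamma> \<psi> V \<theta> (Suc t) ?u ?h" by (simp add: D_def N_def)
      have dens: "(\<lambda>z. f (Suc t) \<theta> z ?h) \<in> borel_measurable \<mu>"
        using measurable_compose[OF measurable_Pair2'[OF h] density_measurable[of "Suc t" \<theta>, unfolded diff_Suc_1]]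
        by simp
      have dens_nonneg: "0 \<le> f (Suc t) \<theta> z ?h" if "z \<in> space \<mu>" for z
        using observation_model.density_nonneg[OF model one_le that] h by simp
      have dens_total: "(\<integral>\<^sup>+z. ennreal (f (Suc t) \<theta> z ?h) \<partial>\<mu>) = 1"
        using density_total[OF one_le] h by simp
      note taylor = integral_taylor_drift[where \<mu> = \<mu> and f = f and \<theta> = \<theta> and t = "Suc t" and h = ?h
        and u = ?u and \<Gamma> = \<Gamma> and \<psi> = \<psi> and V = V, OF V_C2 V_nonneg dens dens_nonneg dens_total
            elim(2)[rule_format, unfolded diff_Suc_1] elim(3)[rule_format, unfolded diff_Suc_1]]
      have bound: "nn_cond_exp (P \<theta>) (?F t) (\<lambda>\<omega>. ennreal (Y (Suc t) \<omega>)) \<omega> \<le> ennreal (Y t \<omega> + D t \<omega>)"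
        and nonneg: "0 \<le> Y t \<omega> + D t \<omega>"
        using taylor elim(1)[unfolded g_next]
        by (simp_all add: g_def e Y_def D)
      have "nn_cond_exp (P \<theta>) (?F t) (\<lambda>\<omega>. ennreal (Y (Suc t) \<omega>)) \<omega> + ennreal (\<zeta> t \<omega>)
          \<le> ennreal (Y t \<omega> + D t \<omega>) + ennreal (\<zeta> t \<omega>)"
        by (rule add_right_mono[OF bound])
      also have "\<dots> = ennreal (Y t \<omega> + D t \<omega> + \<zeta> t \<omega>)"
        using nonneg by (intro ennreal_plus[symmetric]) (auto simp: \<zeta>_def)
      also have "Y t \<omega> + D t \<omega> + \<zeta> t \<omega> = (1 + \<beta> t \<omega>) * Y t \<omega>"
        using Y_pos[of t \<omega>] by (simp add: \<beta>_def \<zeta>_def field_simps max_def)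
      finally show ?case .
    qed
  qed
  have RS: "AE \<omega> in P \<theta>. summable (\<lambda>t. \<beta> t \<omega>) \<longrightarrow> convergent (\<lambda>t. Y t \<omega>) \<and> summable (\<lambda>t. \<zeta> t \<omega>)"
  proof (rule Robbins_Siegmund[OF Y_meas _ start \<beta>_meas _ \<zeta>_meas _ step])
    show "0 \<le> Y t \<omega>" "0 \<le> \<beta> t \<omega>" "0 \<le> \<zeta> t \<omega>" for t \<omega>
      using Y_pos[of t \<omega>] by (auto simp: \<beta>_def \<zeta>_def)
  qed
  define I where "I = (\<lambda>\<omega> \<epsilon> t. INF u\<in>{u. \<epsilon> \<le> V u \<and> V u \<le> 1 / \<epsilon>}. ennreal (max 0 (- N (Suc t) u \<omega>)))"
  have diverges: "AE \<omega> in P \<theta>. \<forall>n. \<omega> \<in> A \<longrightarrow> (\<Sum>t. I \<omega> (1 / (real n + 2)) t) = \<infinity>"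
    unfolding AE_all_countable I_def by (intro allI G2(3)) auto
  show ?thesis using RS G3 diverges
  proof eventually_elim
    case (elim \<omega>)
    show ?case
    proof
      assume "\<omega> \<in> A"
      have sum: "summable (\<lambda>t. \<beta> t \<omega>)" using elim(2) by (simp add: \<beta>_def Y_def D_def)
      then have "convergent (\<lambda>t. Y t \<omega>)" and sum_\<zeta>: "summable (\<lambda>t. \<zeta> t \<omega>)" using elim(1) by auto
      then have conv: "convergent (\<lambda>t. V (\<Delta> t \<omega>))"
        by (simp add: Y_def convergent_add_const_iff)
      have "(\<lambda>t. V (\<Delta> t \<omega>)) \<longlonglongrightarrow> 0"
      proof (rule limit_zero_if_sum_diverges[OF conv V_nonneg sum_\<zeta>])
        show "0 \<le> \<zeta> t \<omega>" for t by (simp add: \<zeta>_def)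
        show "(\<Sum>t. I \<omega> (1 / (real n + 2)) t) = \<infinity>" for n using elim(3) \<open>\<omega> \<in> A\<close> by blast
        show "I \<omega> \<epsilon> t \<le> ennreal (\<zeta> t \<omega>)" if "\<epsilon> \<le> V (\<Delta> t \<omega>)" "V (\<Delta> t \<omega>) \<le> 1 / \<epsilon>" for \<epsilon> t
          unfolding I_def \<zeta>_def D_def using that by (intro INF_lower) auto
        show "I \<omega> \<epsilon> t < \<infinity>" if "\<epsilon> \<le> V (\<Delta> s \<omega>)" "V (\<Delta> s \<omega>) \<le> 1 / \<epsilon>" for \<epsilon> s t
          unfolding I_def using that
          by (intro le_less_trans[OF INF_lower[of "\<Delta> s \<omega>"]]) auto
      qed
      from tendsto_zero_if_potential_tendsto_zero[OF V_nonneg G1(2) this]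
      have "(\<lambda>t. \<Delta> t \<omega>) \<longlonglongrightarrow> 0" .
      then show "(\<lambda>t. estimator X \<Gamma> \<psi> \<theta>0 t \<omega>) \<longlonglongrightarrow> \<theta>"
        unfolding \<Delta>_def by (rule LIM_zero_cancel)
    qed
  qed
qed

end
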